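(* Let $(W,S)$ be a Coxeter system with Coxeter graph $G$ such that $W$ is infinite and irreducible (i.e. $G$ is connected). Then every word in the alphabet $S$ that has the intervening neighbours property with respect to $G$ is irreducible.
   Context: The Coxeter graph $G$ of a Coxeter system $(W,S)$ has vertex set $S$. Two distinct generators $x,y$ are joined by an edge (are neighbours) exactly when the order $m_{xy}$ of $xy$ in $W$ is at least $3$ (possibly $\infty$), and the edge is labelled by $m_{xy}$. A word means a finite sequence of letters of $S$, representing the product of these generators in $W$. A word has the intervening neighbours property (with respect to $G$) if any two occurrences of the same letter are separated by all its graph neighbours: for any two occurrences of a letter $s$ in the word, every neighbour of $s$ in $G$ occurs somewhere strictly between these two occurrences. A word is irreducible (also called reduced) if no strictly shorter word in $S$ represents the same element of $W$. *)

theory Defs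
  imports "HOL-Algebra.Algebra"
begin

section \<open>Group presentations\<close>

text \<open>
  Elements of the free group on \<open>S\<close> are represented by signed words, that is, lists over
  \<open>S \<times> {True, False}\<close>, where \<open>(s, True)\<close> stands for \<open>s\<close> and \<open>(s, False)\<close> for its inverse.
\<close>

type_synonym 'a sword = "('a \<times> bool) list"

definition swords :: "'a set \<Rightarrow> 'a sword set" where
  "swords S = lists (S \<times> UNIV)"

definition sword_eval :: "('a, 'b) monoid_scheme \<Rightarrow> 'a sword \<Rightarrow> 'a" where
  "sword_eval G u = foldr (\<lambda>(s, e) x. (if e then s else inv\<^bsub>G\<^esub> s) \<otimes>\<^bsub>G\<^esub> x) u \<one>\<^bsub>G\<^esub>"

text \<open>
  Two signed words represent the same element of \<open>\<langle>S | r = 1 (r \<in> R)\<rangle>\<close>: the equivalence generated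
  by inserting or deleting cancelling pairs and relators at arbitrary positions.
\<close>

inductive pres_equiv :: "'a set \<Rightarrow> 'a sword set \<Rightarrow> 'a sword \<Rightarrow> 'a sword \<Rightarrow> bool"
  for S R where
  refl: "u \<in> swords S \<Longrightarrow> pres_equiv S R u u"
| sym: "pres_equiv S R u v \<Longrightarrow> pres_equiv S R v u"
| trans: "pres_equiv S R u v \<Longrightarrow> pres_equiv S R v w \<Longrightarrow> pres_equiv S R u w"
| cancel: "u \<in> swords S \<Longrightarrow> v \<in> swords S \<Longrightarrow> s \<in> S \<Longrightarrow>
    pres_equiv S R (u @ [(s, e), (s, \<not> e)] @ v) (u @ v)"
| relator: "u \<in> swords S \<Longrightarrow> v \<in> swords S \<Longrightarrow> r \<in> R \<Longrightarrow>
    pres_equiv S R (u @ r @ v) (u @ v)"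

definition has_presentation ::
  "('a, 'b) monoid_scheme \<Rightarrow> 'a set \<Rightarrow> 'a sword set \<Rightarrow> bool" where
  "has_presentation G S R \<longleftrightarrow>
     group G \<and> S \<subseteq> carrier G \<and> R \<subseteq> swords S \<and>
     generate G S = carrier G \<and>
     (\<forall>u \<in> swords S. \<forall>v \<in> swords S.
        sword_eval G u = sword_eval G v \<longleftrightarrow> pres_equiv S R u v)"


section \<open>Coxeter systems\<close>

text \<open>
  The order \<open>m\<^sub>s\<^sub>t\<close> of \<open>s t\<close> in \<open>W\<close>. As usual for \<^const>\<open>group.ord\<close>, the value \<open>0\<close> encodes \<open>\<infinity>\<close>.
\<close>

definition cox_m :: "('a, 'b) monoid_scheme \<Rightarrow> 'a \<Rightarrow> 'a \<Rightarrow> nat" where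
  "cox_m W s t = group.ord W (s \<otimes>\<^bsub>W\<^esub> t)"

text \<open>
  The relators \<open>(s t)\<^bsup>m(s,t)\<^esup>\<close> for \<open>s, t \<in> S\<close> with finite \<open>m(s,t)\<close>; the case \<open>s = t\<close> gives \<open>s s\<close>,
  since \<open>m(s,s) = 1\<close> in a Coxeter system.
\<close>

definition cox_relators :: "('a, 'b) monoid_scheme \<Rightarrow> 'a set \<Rightarrow> 'a sword set" where
  "cox_relators W S =
     {concat (replicate (cox_m W s t) [(s, True), (t, True)]) | s t.
        s \<in> S \<and> t \<in> S \<and> cox_m W s t \<noteq> 0}"

text \<open>
  Bourbaki's definition. The generating set \<open>S\<close> is not required to be finite.
\<close>

definition coxeter_system :: "('a, 'b) monoid_scheme \<Rightarrow> 'a set \<Rightarrow> bool" where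
  "coxeter_system W S \<longleftrightarrow>
     group W \<and> S \<subseteq> carrier W \<and> (\<forall>s \<in> S. group.ord W s = 2) \<and>
     has_presentation W S (cox_relators W S)"

definition cox_edges :: "('a, 'b) monoid_scheme \<Rightarrow> 'a set \<Rightarrow> ('a \<times> 'a) set" where
  "cox_edges W S =
     {(s, t). s \<in> S \<and> t \<in> S \<and> s \<noteq> t \<and> (cox_m W s t \<ge> 3 \<or> cox_m W s t = 0)}"

definition coxeter_irreducible :: "('a, 'b) monoid_scheme \<Rightarrow> 'a set \<Rightarrow> bool" where
  "coxeter_irreducible W S \<longleftrightarrow> (\<forall>s \<in> S. \<forall>t \<in> S. (s, t) \<in> (cox_edges W S)\<^sup>*)"


section \<open>Words in the generators\<close>

definition word_prod :: "('a, 'b) monoid_scheme \<Rightarrow> 'a list \<Rightarrow> 'a" where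
  "word_prod W w = foldr (\<lambda>s x. s \<otimes>\<^bsub>W\<^esub> x) w \<one>\<^bsub>W\<^esub>"

definition intervening_neighbours ::
  "('a, 'b) monoid_scheme \<Rightarrow> 'a set \<Rightarrow> 'a list \<Rightarrow> bool" where
  "intervening_neighbours W S w \<longleftrightarrow>
     (\<forall>i j. i < j \<and> j < length w \<and> w ! i = w ! j \<longrightarrow>
        (\<forall>t. (w ! i, t) \<in> cox_edges W S \<longrightarrow> (\<exists>k. i < k \<and> k < j \<and> w ! k = t)))"

definition reduced_word :: "('a, 'b) monoid_scheme \<Rightarrow> 'a set \<Rightarrow> 'a list \<Rightarrow> bool" where
  "reduced_word W S w \<longleftrightarrow>
     w \<in> lists S \<and>
     \<not> (\<exists>v \<in> lists S. length v < length w \<and> word_prod W v = word_prod W w)"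

end

theory Submission
  imports Defs "HOL-Analysis.Analysis"
begin

text \<open>
  Let \<open>S\<close> act on functions \<open>S \<Rightarrow> \<real>\<close> by the contragredient geometric representation (the numbers game).
  A word with intervening neighbours always fires a source of a changing orientation \<open>r\<close> of the
  Coxeter graph and turns it into a sink, the initial orientation being given by first occurrences.
  Since \<open>W\<close> is infinite and irreducible, there is \<open>\<delta> > 0\<close> on the letters of the word with
  \<open>2 \<delta>\<^sub>x \<le> \<Sum>\<^sub>y k\<^sub>x\<^sub>y \<delta>\<^sub>y\<close>, where \<open>k\<^sub>x\<^sub>y = 2 cos (\<pi> / m\<^sub>x\<^sub>y)\<close>.  For the Euler form \<open>E\<^sub>r\<close> of the orientation,
  \<open>E\<^sub>r(\<delta>, \<beta>)\<close> does not increase along the word while the moving root \<open>\<beta>\<close> stays positive; it is negative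
  right after \<open>\<beta> = \<alpha>\<^sub>s\<close> was created at a sink \<open>s\<close>, and it would be \<open>\<delta>\<^sub>t > 0\<close> if \<open>\<beta>\<close> reached \<open>\<alpha>\<^sub>t\<close>
  at a source \<open>t\<close>.  So no root becomes negative, and the word is reduced.

  The vector \<open>\<delta>\<close> is built from the bottom eigenvector \<open>p\<close> of the Coxeter form on a finite connected set
  of generators: if the eigenvalue is not positive, take \<open>\<delta> = p\<close>; if it is positive and a neighbouring
  generator is left over, solve \<open>2 \<delta>\<^sub>x = \<Sum>\<^sub>y k\<^sub>x\<^sub>y \<delta>\<^sub>y\<close> with value 1 at that neighbour; otherwise the form
  of \<open>W\<close> is positive definite and \<open>W\<close> is finite.
\<close>


section \<open>The numbers game\<close>

text \<open>\<open>f\<close> lists the values of a functional on the simple roots. When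
  \<open>k s s = -2\<close>, firing \<open>s\<close> composes it with the reflection in \<alpha>_s,
  so \<open>fire_word k w f t\<close> is its value on the root w \<alpha>_t.\<close>

definition fire :: "('a \<Rightarrow> 'a \<Rightarrow> real) \<Rightarrow> 'a \<Rightarrow> ('a \<Rightarrow> real) \<Rightarrow> 'a \<Rightarrow> real" where
  "fire k s f = (\<lambda>t. f t + k s t * f s)"

abbreviation fire_word :: "('a \<Rightarrow> 'a \<Rightarrow> real) \<Rightarrow> 'a list \<Rightarrow> ('a \<Rightarrow> real) \<Rightarrow> 'a \<Rightarrow> real" where
  "fire_word k w f \<equiv> fold (fire k) w f"

lemma fire_word_linear:
  "fire_word k w (\<lambda>x. a * f x + b * g x) t = a * fire_word k w f t + b * fire_word k w g t"
proof (induction w arbitrary: f g)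
  case (Cons s w)
  have "fire k s (\<lambda>x. a * f x + b * g x) = (\<lambda>x. a * fire k s f x + b * fire k s g x)"
    by (simp add: fire_def algebra_simps)
  then show ?case using Cons by simp
qed simp

lemma fire_word_add: "fire_word k w (\<lambda>x. f x + g x) t = fire_word k w f t + fire_word k w g t"
  using fire_word_linear[of k w 1 f 1 g t] by simp

lemma fire_word_diff: "fire_word k w (\<lambda>x. f x - g x) t = fire_word k w f t - fire_word k w g t"
  using fire_word_linear[of k w 1 f "-1" g t] by simp

lemma fire_word_scale: "fire_word k w (\<lambda>x. a * f x) t = a * fire_word k w f t"
  using fire_word_linear[of k w a f 0 f t] by simp

lemma fire_fire:
  assumes "k s s = -2"
  shows "fire k s (fire k s f) = f"
  using assms by (simp add: fire_def algebra_simps)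

section \<open>Rank two: alternating words and Chebyshev polynomials\<close>

fun alternating :: "'a \<Rightarrow> 'a \<Rightarrow> nat \<Rightarrow> 'a list" where
  "alternating x y 0 = []"
| "alternating x y (Suc n) = x # alternating y x n"

lemma length_alternating [simp]: "length (alternating x y n) = n"
  by (induction x y n rule: alternating.induct) auto

lemma set_alternating: "set (alternating x y n) \<subseteq> {x, y}"
  by (induction x y n rule: alternating.induct) auto

lemma alternating_Suc_right:
  "alternating x y (Suc n) = alternating x y n @ [if even n then x else y]"
  by (induction x y n rule: alternating.induct) auto

lemma alternating_double: "alternating x y (2 * m) = concat (replicate m [x, y])"
  by (induction m) auto

lemma distinct_adj_alternating:
  assumes "distinct_adj u" and "set u \<subseteq> {x, y}" and "x \<noteq> y"
  shows "u = alternating x y (length u) \<or> u = alternating y x (length u)"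
  using assms
proof (induction u)
  case (Cons a u)
  then show ?case by (cases u) auto
qed simp

text \<open>
  Chebyshev polynomials of the second kind, with the index shifted by one and the argument doubled
  against the usual convention, so that \<open>cheb (2 cos \<theta>) n = sin (n \<theta>) / sin \<theta>\<close>.
\<close>

fun cheb :: "real \<Rightarrow> nat \<Rightarrow> real" where
  "cheb c 0 = 0"
| "cheb c (Suc 0) = 1"
| "cheb c (Suc (Suc n)) = c * cheb c (Suc n) - cheb c n"

lemma cheb_cos: "cheb (2 * cos \<theta>) n * sin \<theta> = sin (n * \<theta>)"
proof (induction "2 * cos \<theta>" n rule: cheb.induct)
  case (3 n)
  have "sin (real (Suc (Suc n)) * \<theta>) + sin (real n * \<theta>) = 2 * cos \<theta> * sin (real (Suc n) * \<theta>)"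
    using sin_add[of "real (Suc n) * \<theta>" \<theta>] sin_diff[of "real (Suc n) * \<theta>" \<theta>]
    by (simp add: algebra_simps)
  then show ?case using 3 by (simp add: algebra_simps)
qed auto

lemma cheb_2: "cheb 2 n = n"
  by (induction "2::real" n rule: cheb.induct) auto

text \<open>The letter evaluated is the one whose turn is next. Removing the first letter swaps
  \<open>x\<close> and \<open>y\<close>, and its firing advances the coefficients by the recurrence
  of \<open>cheb\<close>.\<close>

lemma fire_alternating_next:
  assumes "k x y = c" "k y x = c" "k x x = -2" "k y y = -2"
  shows "fire_word k (alternating x y n) f (if even n then x else y) =
    cheb c (Suc n) * f x + cheb c n * f y"
  using assms
proof (induction x y n arbitrary: f rule: alternating.induct)
  case (2 x y n)
  have "fire_word k (alternating x y (Suc n)) f (if even (Suc n) then x else y)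
      = fire_word k (alternating y x n) (fire k x f) (if even n then y else x)" by simp
  also have "\<dots> = cheb c (Suc n) * fire k x f y + cheb c n * fire k x f x"
    using 2 by simp
  also have "\<dots> = cheb c (Suc (Suc n)) * f x + cheb c (Suc n) * f y"
    using 2(2-5) by (simp add: fire_def algebra_simps)
  finally show ?case .
qed auto

lemma fire_alternating:
  assumes "k x y = c" "k y x = c" "k x x = -2" "k y y = -2"
  shows "fire_word k (alternating x y (2 * m)) f z = f z
    + k x z * (\<Sum>j<m. cheb c (2*j+1) * f x + cheb c (2*j) * f y)
    + k y z * (\<Sum>j<m. cheb c (2*j+2) * f x + cheb c (2*j+1) * f y)"
proof (induction m)
  case (Suc m)
  have 1: "fire_word k (alternating x y (Suc (2*m))) f z =
      fire_word k (alternating x y (2*m)) f z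
      + k x z * (cheb c (2*m+1) * f x + cheb c (2*m) * f y)" for z
    using fire_alternating_next[OF assms, of "2*m" f]
    unfolding alternating_Suc_right by (simp add: fire_def)
  have 2: "fire_word k (alternating x y (Suc (Suc (2*m)))) f z =
      fire_word k (alternating x y (Suc (2*m))) f z
      + k y z * (cheb c (2*m+2) * f x + cheb c (2*m+1) * f y)" for z
    using fire_alternating_next[OF assms, of "Suc (2*m)" f]
    unfolding alternating_Suc_right[of _ _ "Suc (2*m)"] by (simp add: fire_def del: alternating.simps)
  have "2 * Suc m = Suc (Suc (2*m))" by simp
  then show ?case unfolding \<open>2 * Suc m = Suc (Suc (2*m))\<close> 2 1 Suc.IH
    by (simp add: algebra_simps)
qed simp

text \<open>By the first two assumptions the sequence has period \<open>2 * m\<close>, so shifting a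
  sum by two indices preserves it. The recurrence then gives \<open>c * Od = 2 * E\<close> and
  \<open>c * E = 2 * Od\<close>, and \<open>c\<^sup>2 \<noteq> 4\<close> leaves only zero.\<close>

lemma cheb_sums_zero:
  assumes "cheb c (2*m) = 0" "cheb c (2*m+1) = 1" "c\<^sup>2 \<noteq> 4"
  shows "(\<Sum>j<m. cheb c (2*j)) = 0" "(\<Sum>j<m. cheb c (2*j+1)) = 0" "(\<Sum>j<m. cheb c (2*j+2)) = 0"
proof -
  define E where "E = (\<Sum>j<m. cheb c (2*j))"
  define Od where "Od = (\<Sum>j<m. cheb c (2*j+1))"
  define E' where "E' = (\<Sum>j<m. cheb c (2*j+2))"
  have tele: "(\<Sum>j<m. g (Suc j)) = (\<Sum>j<m. g j) + g m - g 0" for g :: "nat \<Rightarrow> real"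
    by (induction m) auto
  have E': "E' = E"
    using tele[of "\<lambda>j. cheb c (2*j)"] assms by (simp add: E_def E'_def)
  have O': "(\<Sum>j<m. cheb c (2*j+3)) = Od"
    using tele[of "\<lambda>j. cheb c (2*j+1)"] assms by (simp add: Od_def numeral_3_eq_3)
  have "c * Od = (\<Sum>j<m. cheb c (2*j+2) + cheb c (2*j))"
    unfolding Od_def sum_distrib_left by (rule sum.cong) auto
  then have 1: "c * Od = 2 * E" using E' unfolding sum.distrib E_def E'_def by linarith
  have "c * E' = (\<Sum>j<m. cheb c (2*j+3) + cheb c (2*j+1))"
    unfolding E'_def sum_distrib_left by (rule sum.cong) (auto simp: numeral_3_eq_3)
  then have 2: "c * E = 2 * Od" unfolding E' sum.distrib O' Od_def[symmetric] by simp
  have "c\<^sup>2 * E = c * (c * E)" by (simp add: power2_eq_square)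
  also have "\<dots> = 2 * (c * Od)" unfolding 2 by simp
  also have "\<dots> = 4 * E" unfolding 1 by simp
  finally have "c\<^sup>2 * E = 4 * E" .
  then have "E = 0" using assms by simp
  moreover have "Od = 0" using 2 \<open>E = 0\<close> by simp
  ultimately show "(\<Sum>j<m. cheb c (2*j)) = 0" "(\<Sum>j<m. cheb c (2*j+1)) = 0"
    "(\<Sum>j<m. cheb c (2*j+2)) = 0" using E' by (simp_all add: E_def E'_def Od_def)
qed

lemma sin_pi_div_pos:
  assumes "m \<ge> 2"
  shows "sin (pi / real m) > 0"
  using assms by (intro sin_gt_zero) (auto simp: field_simps)

text \<open>At the angle \<open>pi / m\<close> the Chebyshev coefficients have period
  \<open>2 * m\<close>, so the total change at every vertex, also outside \<open>{x, y}\<close>, is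
  zero.\<close>

lemma fire_relator:
  assumes k: "k x y = 2 * cos (pi / m)" "k y x = 2 * cos (pi / m)" "k x x = -2" "k y y = -2"
    and "m \<ge> 2"
  shows "fire_word k (alternating x y (2 * m)) f = f"
proof -
  let ?\<theta> = "pi / m" and ?c = "2 * cos (pi / m)"
  have s: "sin ?\<theta> > 0" using sin_pi_div_pos[OF \<open>m \<ge> 2\<close>] .
  have "cheb ?c (2*m) * sin ?\<theta> = 0"
    unfolding cheb_cos using \<open>m \<ge> 2\<close> by simp
  then have 1: "cheb ?c (2*m) = 0" using s by simp
  have "cheb ?c (2*m+1) * sin ?\<theta> = sin (2*pi + ?\<theta>)"
    unfolding cheb_cos using \<open>m \<ge> 2\<close> by (simp add: field_simps)
  also have "\<dots> = sin ?\<theta>" by (simp add: sin_add)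
  finally have 2: "cheb ?c (2*m+1) = 1" using s by simp
  have 3: "?c\<^sup>2 \<noteq> 4"
    using s sin_squared_eq[of ?\<theta>] by (auto simp: power_mult_distrib)
  show ?thesis
    using cheb_sums_zero[OF 1 2 3]
    by (simp add: fun_eq_iff fire_alternating[OF k] sum.distrib flip: sum_distrib_right)
qed

lemma take_alternating: "take i (alternating x y n) = alternating x y (min i n)"
proof (induction x y n arbitrary: i rule: alternating.induct)
  case (2 x y n)
  then show ?case by (cases i) auto
qed simp

lemma not_distinct_adj_split:
  assumes "\<not> distinct_adj w"
  obtains a x b where "w = a @ [x, x] @ b"
proof -
  obtain i where i: "Suc i < length w" "w ! i = w ! Suc i"
    using assms by (auto simp: distinct_adj_conv_nth)
  have "w = take i w @ [w ! i, w ! Suc i] @ drop (Suc (Suc i)) w"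
    using i(1) by (metis Cons_nth_drop_Suc Suc_lessD append_Cons append_Nil append_take_drop_id)
  then show thesis using that i by metis
qed


section \<open>Positivity of roots\<close>

text \<open>Minus twice the Coxeter form on the simple roots. The order 0 encodes infinity and gets
  the limit value 2; on the diagonal the order is 1, which gives -2.\<close>

definition cox_k :: "('a, 'b) monoid_scheme \<Rightarrow> 'a \<Rightarrow> 'a \<Rightarrow> real" where
  "cox_k W s t = (if cox_m W s t = 0 then 2 else 2 * cos (pi / cox_m W s t))"

locale coxeter =
  fixes W :: "('a, 'b) monoid_scheme" (structure) and S :: "'a set"
  assumes cox: "coxeter_system W S"
begin

sublocale group W
  using cox by (simp add: coxeter_system_def)

abbreviation k :: "'a \<Rightarrow> 'a \<Rightarrow> real" where "k \<equiv> cox_k W"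
abbreviation m :: "'a \<Rightarrow> 'a \<Rightarrow> nat" where "m \<equiv> cox_m W"
abbreviation prod_w :: "'a list \<Rightarrow> 'a" where "prod_w \<equiv> word_prod W"

lemma S_carrier: "s \<in> S \<Longrightarrow> s \<in> carrier W"
  using cox by (auto simp: coxeter_system_def)

lemma lists_S_carrier: "w \<in> lists S \<Longrightarrow> set w \<subseteq> carrier W"
  using S_carrier by auto

lemma S_square: "s \<in> S \<Longrightarrow> s \<otimes> s = \<one>"
  using cox pow_eq_id[of s 2] S_carrier[of s]
  by (simp add: coxeter_system_def numeral_2_eq_2)

lemma S_inv: "s \<in> S \<Longrightarrow> inv s = s"
  using S_square S_carrier by (simp add: inv_equality)

lemma m_pow: "s \<in> S \<Longrightarrow> t \<in> S \<Longrightarrow> (s \<otimes> t) [^] (n::nat) = \<one> \<longleftrightarrow> m s t dvd n"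
  by (simp add: cox_m_def pow_eq_id S_carrier)

lemma m_self: "s \<in> S \<Longrightarrow> m s s = 1"
  using m_pow[of s s 1] by (simp add: S_square)

lemma m_not_1:
  assumes "s \<in> S" "t \<in> S" "s \<noteq> t"
  shows "m s t \<noteq> 1"
proof
  assume "m s t = 1"
  then have "s \<otimes> t = \<one>" using m_pow[OF assms(1,2), of 1] assms by (simp add: S_carrier)
  then have "inv t = s" using assms by (simp add: S_carrier inv_equality)
  then show False using assms S_inv by simp
qed

lemma m_sym:
  assumes "s \<in> S" "t \<in> S"
  shows "m s t = m t s"
proof -
  have inv: "inv (s \<otimes> t) = t \<otimes> s"
    using assms by (simp add: S_carrier inv_mult_group S_inv)
  have "m s t dvd n \<longleftrightarrow> m t s dvd n" for n
    using assms by (simp add: m_pow[symmetric] inv[symmetric] S_carrier nat_pow_inv)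
  then show ?thesis by (meson dvd_antisym dvd_refl)
qed

lemma k_sym: "s \<in> S \<Longrightarrow> t \<in> S \<Longrightarrow> k s t = k t s"
  by (simp add: cox_k_def m_sym)

lemma k_self: "s \<in> S \<Longrightarrow> k s s = -2"
  by (simp add: cox_k_def m_self)

lemma k_nonneg:
  assumes "s \<in> S" "t \<in> S" "s \<noteq> t"
  shows "k s t \<ge> 0"
proof (cases "m s t = 0")
  case False
  then have "m s t \<ge> 2" using m_not_1[OF assms] by linarith
  then have "pi / m s t \<le> pi / 2" by (intro divide_left_mono) auto
  moreover have "0 \<le> pi / m s t" by simp
  ultimately have "cos (pi / m s t) \<ge> 0" using pi_gt_zero by (intro cos_ge_zero) linarith+
  then show ?thesis using False by (simp add: cox_k_def)
qed (simp add: cox_k_def)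

lemma k_edge:
  assumes "(s, t) \<in> cox_edges W S"
  shows "k s t > 0"
proof (cases "m s t = 0")
  case False
  then have "m s t \<ge> 3" using assms by (auto simp: cox_edges_def)
  then have "pi / m s t \<le> pi / 3" by (intro divide_left_mono) auto
  also have "\<dots> < pi / 2" by simp
  finally show ?thesis using False pi_gt_zero
    by (auto simp: cox_k_def intro!: cos_gt_zero)
qed (simp add: cox_k_def)

lemma k_non_edge:
  assumes "s \<in> S" "t \<in> S" "s \<noteq> t" "(s, t) \<notin> cox_edges W S"
  shows "k s t = 0"
proof -
  have "m s t = 2" using m_not_1[OF assms(1-3)] assms by (auto simp: cox_edges_def)
  then show ?thesis by (simp add: cox_k_def)
qed

lemma edge_sym: "(s, t) \<in> cox_edges W S \<Longrightarrow> (t, s) \<in> cox_edges W S"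
  by (auto simp: cox_edges_def m_sym)

section \<open>Words, relations and their invariants\<close>

lemma prod_w_simps [simp]:
  "prod_w [] = \<one>" "prod_w (s # w) = s \<otimes> prod_w w"
  by (simp_all add: word_prod_def)

lemma prod_w_closed: "set w \<subseteq> carrier W \<Longrightarrow> prod_w w \<in> carrier W"
  by (induction w) auto

lemma prod_w_S: "w \<in> lists S \<Longrightarrow> prod_w w \<in> carrier W"
  using prod_w_closed lists_S_carrier by blast

lemma prod_w_append:
  "u \<in> lists S \<Longrightarrow> v \<in> lists S \<Longrightarrow> prod_w (u @ v) = prod_w u \<otimes> prod_w v"
  by (induction u) (auto simp: prod_w_S S_carrier m_assoc)

lemma prod_w_rev:
  assumes "w \<in> lists S"
  shows "prod_w (rev w) = inv (prod_w w)"
  using assms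
proof (induction w)
  case (Cons a w)
  then have "rev w \<in> lists S" "[a] \<in> lists S" by auto
  from prod_w_append[OF this] Cons show ?case
    by (simp add: prod_w_S S_carrier S_inv inv_mult_group)
qed simp

lemma prod_w_alternating:
  assumes "s \<in> S" "t \<in> S"
  shows "prod_w (alternating s t (2 * n)) = (s \<otimes> t) [^] n"
proof (induction n)
  case (Suc n)
  have "alternating s t (2 * n) \<in> lists S"
    using set_alternating[of s t] assms by fastforce
  then have "prod_w (alternating s t (2 * n)) \<in> carrier W" by (rule prod_w_S)
  moreover have "(s \<otimes> t) [^] Suc n = s \<otimes> t \<otimes> (s \<otimes> t) [^] n"
    using assms by (intro nat_pow_Suc2) (simp add: S_carrier)
  ultimately show ?case using Suc assms by (simp add: S_carrier m_assoc del: nat_pow_Suc)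
qed simp

text \<open>This makes the numbers game an action of \<open>W\<close> and fixes the parity of words.
  \<open>map fst\<close> may forget signs because firing a letter twice is the identity; relators
  act trivially and have even length.\<close>

lemma relation_invariants:
  assumes "pres_equiv S (cox_relators W S) u v"
  shows "fire_word k (map fst u) f = fire_word k (map fst v) f \<and> even (length u) = even (length v)"
  using assms
proof (induction arbitrary: f rule: pres_equiv.induct)
  case (cancel u v s e)
  then show ?case by (simp add: fire_fire k_self)
next
  case (relator u v r)
  then obtain s t where r: "s \<in> S" "t \<in> S" "m s t \<noteq> 0"
      "r = concat (replicate (m s t) [(s, True), (t, True)])"
    by (auto simp: cox_relators_def)
  have r': "map fst r = alternating s t (2 * m s t)"
    by (simp add: r(4) map_concat alternating_double)
  have "fire_word k (map fst r) f = f" for f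
  proof (cases "s = t")
    case True
    then show ?thesis unfolding r' using r(1) by (simp add: m_self k_self fire_fire numeral_2_eq_2)
  next
    case False
    then have "m s t \<ge> 2" using m_not_1 r by (metis One_nat_def less_2_cases not_le)
    then show ?thesis unfolding r' using r
      by (intro fire_relator) (simp_all add: cox_k_def k_self[unfolded cox_k_def] m_sym)
  qed
  moreover have "length r = 2 * m s t" using r' by (metis length_alternating length_map)
  ultimately show ?case by simp
qed auto

lemma equal_products:
  assumes "u \<in> lists S" "v \<in> lists S" "prod_w u = prod_w v"
  shows "fire_word k u = fire_word k v" and "even (length u) = even (length v)"
proof -
  define \<phi> where "\<phi> = map (\<lambda>s::'a. (s, True))"
  have ev: "sword_eval W (\<phi> w) = prod_w w" for w
    by (simp add: sword_eval_def \<phi>_def word_prod_def foldr_map comp_def)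
  have "\<phi> u \<in> swords S" "\<phi> v \<in> swords S"
    using assms by (auto simp: \<phi>_def swords_def)
  then have "pres_equiv S (cox_relators W S) (\<phi> u) (\<phi> v)"
    using cox assms(3) unfolding coxeter_system_def has_presentation_def ev[symmetric] by blast
  note * = relation_invariants[OF this]
  have "map fst (\<phi> w) = w" for w by (simp add: \<phi>_def comp_def)
  then show "fire_word k u = fire_word k v" and "even (length u) = even (length v)"
    using * by (auto simp: \<phi>_def)
qed

lemma ex_word:
  assumes "g \<in> carrier W"
  shows "\<exists>w \<in> lists S. prod_w w = g"
proof -
  have "g \<in> generate W S" using cox assms by (simp add: coxeter_system_def has_presentation_def)
  then show ?thesis
  proof induction
    case one
    then show ?case by (intro bexI[of _ "[]"]) auto
  next
    case (incl h)
    then show ?case by (intro bexI[of _ "[h]"]) (auto simp: S_carrier)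
  next
    case (inv h)
    then show ?case by (intro bexI[of _ "[h]"]) (auto simp: S_carrier S_inv)
  next
    case (eng h1 h2)
    then obtain w1 w2 where "w1 \<in> lists S" "w2 \<in> lists S" "prod_w w1 = h1" "prod_w w2 = h2" by blast
    then show ?case by (intro bexI[of _ "w1 @ w2"]) (auto simp: prod_w_append)
  qed
qed

section \<open>The length function\<close>

definition len :: "'a \<Rightarrow> nat" where
  "len g = (LEAST n. \<exists>w \<in> lists S. length w = n \<and> prod_w w = g)"

lemma len_le: "w \<in> lists S \<Longrightarrow> len (prod_w w) \<le> length w"
  unfolding len_def by (rule Least_le) auto

lemma len_word:
  assumes "g \<in> carrier W"
  obtains w where "w \<in> lists S" "length w = len g" "prod_w w = g"
proof -
  have "\<exists>n. \<exists>w \<in> lists S. length w = n \<and> prod_w w = g" using ex_word[OF assms] by auto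
  from LeastI_ex[OF this] show thesis using that unfolding len_def by blast
qed

lemma reduced_word_iff: "reduced_word W S w \<longleftrightarrow> w \<in> lists S \<and> len (prod_w w) = length w"
proof (cases "w \<in> lists S")
  case True
  obtain v where v: "v \<in> lists S" "length v = len (prod_w w)" "prod_w v = prod_w w"
    using len_word[OF prod_w_S[OF True]] by metis
  show ?thesis unfolding reduced_word_def
    using True v len_le[OF True] len_le by (metis le_neq_implies_less not_le)
qed (simp add: reduced_word_def)

lemma len_mult_le: 
  assumes "g \<in> carrier W" "w \<in> lists S"
  shows "len (g \<otimes> prod_w w) \<le> len g + length w"
proof -
  obtain v where v: "v \<in> lists S" "length v = len g" "prod_w v = g"
    using len_word[OF assms(1)] by metis
  then show ?thesis using len_le[of "v @ w"] assms by (simp add: prod_w_append)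
qed

text \<open>A generator changes the length by at most one, and the parity invariant excludes
  equality.\<close>

lemma len_mult_gen:
  assumes "g \<in> carrier W" "s \<in> S"
  shows "len (g \<otimes> s) = len g + 1 \<or> len g = len (g \<otimes> s) + 1"
proof -
  have gs: "g \<otimes> s \<in> carrier W" "g \<otimes> s \<otimes> s = g"
    using assms by (simp_all add: S_carrier m_assoc S_square)
  have 1: "len (g \<otimes> s) \<le> len g + 1"
    using len_mult_le[OF assms(1), of "[s]"] assms by (simp add: S_carrier)
  have 2: "len g \<le> len (g \<otimes> s) + 1"
    using len_mult_le[OF gs(1), of "[s]"] assms gs by (simp add: S_carrier)
  obtain v where v: "v \<in> lists S" "length v = len g" "prod_w v = g"
    using len_word[OF assms(1)] by metis
  obtain u where u: "u \<in> lists S" "length u = len (g \<otimes> s)" "prod_w u = g \<otimes> s"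
    using len_word[OF gs(1)] by metis
  have "prod_w (v @ [s]) = prod_w u" using v u assms by (simp add: prod_w_append S_carrier)
  from equal_products(2)[OF _ _ this] have "even (Suc (len g)) = even (len (g \<otimes> s))"
    using u v assms by auto
  then show ?thesis using 1 2 by presburger
qed

lemma len_cons_word:
  assumes "len g > 0" "g \<in> carrier W"
  obtains t where "t \<in> S" "len g = len (g \<otimes> t) + 1"
proof -
  obtain v where v: "v \<in> lists S" "length v = len g" "prod_w v = g"
    using len_word[OF assms(2)] by metis
  then obtain u t where vu: "v = u @ [t]" using assms(1) by (cases v rule: rev_cases) auto
  then have t: "t \<in> S" "u \<in> lists S" using v by auto
  have "g = prod_w u \<otimes> t"
    using v(3) t prod_w_append[of u "[t]"] by (simp add: vu S_carrier)
  then have "g \<otimes> t = prod_w u"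
    using t prod_w_S[OF t(2)] by (simp add: S_carrier m_assoc S_square)
  then have "len (g \<otimes> t) < len g" using len_le[OF t(2)] v vu by simp
  then show thesis using that t len_mult_gen[OF assms(2) t(1)] by force
qed

text \<open>Equal adjacent letters would cancel, so a shortest word alternates. If it were too long,
  part of a relator could be replaced by the shorter inverse of the rest.\<close>

lemma minimal_dihedral_word:
  assumes st: "s \<in> S" "t \<in> S" "s \<noteq> t"
    and u: "u \<in> lists {s, t}"
    and min: "\<And>u'. u' \<in> lists {s, t} \<Longrightarrow> prod_w u' = prod_w u \<Longrightarrow> length u \<le> length u'"
  shows "(u = alternating s t (length u) \<or> u = alternating t s (length u))
    \<and> (m s t \<noteq> 0 \<longrightarrow> length u \<le> m s t)"
proof -
  have inS: "w \<in> lists S" if "w \<in> lists {s, t}" for w using that st by auto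
  have "distinct_adj u"
  proof (rule ccontr)
    assume "\<not> distinct_adj u"
    then obtain a x b where ab: "u = a @ [x, x] @ b" using not_distinct_adj_split by blast
    have "a \<in> lists {s, t}" "b \<in> lists {s, t}" "x \<in> {s, t}" using u ab by auto
    moreover from this have "a \<in> lists S" "b \<in> lists S" "x \<in> S" using inS st by auto
    ultimately have "prod_w (a @ b) = prod_w u" "a @ b \<in> lists {s, t}"
      unfolding ab by (auto simp: prod_w_append prod_w_S S_carrier S_square simp flip: m_assoc)
    from min[OF this(2,1)] show False by (simp add: ab)
  qed
  then have alt: "u = alternating s t (length u) \<or> u = alternating t s (length u)"
    using distinct_adj_alternating[of u s t] u st by auto
  moreover have "length u \<le> m s t" if "m s t \<noteq> 0"
  proof (rule ccontr)
    assume long: "\<not> length u \<le> m s t"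
    obtain x y where xy: "u = alternating x y (length u)" "{x, y} = {s, t}"
      using alt by blast
    then have xyS: "x \<in> S" "y \<in> S" using st by auto
    \<comment> \<open>The first \<open>m s t + 1\<close> letters of the relator equal the inverse of
      its remaining \<open>m s t - 1\<close> letters.\<close>
    let ?n = "Suc (m s t)"
    have mxy: "m x y = m s t" using xy(2) st m_sym by (auto simp: doubleton_eq_iff)
    let ?a = "alternating x y (2 * m s t)"
    have a: "set ?a \<subseteq> {s, t}" using set_alternating xy by metis
    define p q r where "p = take ?n ?a" and "q = drop ?n ?a" and "r = drop ?n u"
    have "take ?n u = alternating x y ?n"
      using long by (subst xy(1)) (simp only: take_alternating, simp)
    moreover have "p = alternating x y ?n"
      unfolding p_def take_alternating using that by (simp add: min_def)
    ultimately have ur: "u = p @ r" by (metis r_def append_take_drop_id)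
    have pq: "?a = p @ q" by (simp add: p_def q_def)
    have lists: "p \<in> lists {s, t}" "q \<in> lists {s, t}" "r \<in> lists {s, t}"
      using a u pq ur by auto
    note listsS = this[THEN inS]
    have "prod_w p \<otimes> prod_w q = \<one>"
      using prod_w_alternating[OF xyS, of "m s t"] m_pow[OF xyS, of "m s t"] listsS
      by (simp add: pq mxy prod_w_append)
    then have "prod_w p = prod_w (rev q)"
      using listsS by (simp add: prod_w_rev prod_w_S inv_equality[symmetric])
    moreover have "rev q \<in> lists S" using listsS(2) by auto
    ultimately have "prod_w (rev q @ r) = prod_w u"
      using listsS by (simp add: ur prod_w_append)
    moreover have "rev q @ r \<in> lists {s, t}" using lists by auto
    ultimately have "length u \<le> length (rev q @ r)" using min by blast
    then show False using that long by (simp add: q_def r_def)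
  qed
  ultimately show ?thesis by blast
qed

text \<open>For finite order the angle \<open>n * pi / m s t\<close> is at most \<pi>, so its sine
  is nonnegative; for infinite order \<open>cheb 2 n = n\<close>.\<close>

lemma cheb_nonneg:
  assumes "s \<in> S" "t \<in> S" "s \<noteq> t" and "m s t \<noteq> 0 \<Longrightarrow> n \<le> m s t"
  shows "cheb (k s t) n \<ge> 0"
proof (cases "m s t = 0")
  case True
  then show ?thesis by (simp add: cox_k_def cheb_2)
next
  case False
  then have "m s t \<ge> 2" using m_not_1[OF assms(1-3)] by linarith
  have "real n * (pi / m s t) \<le> pi" using assms(4)[OF False] False
    by (simp add: field_simps)
  then have "cheb (k s t) n * sin (pi / m s t) \<ge> 0"
    using False by (simp add: cox_k_def cheb_cos sin_ge_zero)
  then show ?thesis using sin_pi_div_pos[OF \<open>m s t \<ge> 2\<close>] by (simp add: zero_le_mult_iff)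
qed

text \<open>
  The functional \<open>f \<mapsto> fire_word k w f s\<close> is the root \<open>w \<alpha>\<^sub>s\<close>, and its coordinates in the simple
  roots are its values on indicator functions.  So this says that \<open>w \<alpha>\<^sub>s\<close> is a positive root
  whenever \<open>len (w s) > len w\<close>.
\<close>

theorem positive_root:
  assumes "w \<in> lists S" "s \<in> S" "len (prod_w w \<otimes> s) > len (prod_w w)"
    and "\<And>x. x \<in> S \<Longrightarrow> f x \<ge> 0"
  shows "fire_word k w f s \<ge> 0"
  using assms(1-3)
proof (induction "len (prod_w w)" arbitrary: w s rule: less_induct)
  case less
  define g where "g = prod_w w"
  have g: "g \<in> carrier W" using less.prems by (simp add: g_def prod_w_S)
  show ?case
  proof (cases "len g = 0")
    case True
    then obtain v where "v \<in> lists S" "v = []" "prod_w v = g" using len_word[OF g] by force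
    then have "fire_word k w = fire_word k []"
      using equal_products(1)[OF less.prems(1), of "[]"] by (simp add: g_def)
    then show ?thesis using assms(4) less.prems by simp
  next
    case False
    then obtain t where t: "t \<in> S" "len g = len (g \<otimes> t) + 1"
      using len_cons_word[OF _ g] by auto
    have st: "s \<noteq> t" using t less.prems(3) by (auto simp: g_def)
    \<comment> \<open>Factorizations of \<open>g\<close> without loss of length whose right factor
      lies in the dihedral subgroup of \<open>s\<close> and \<open>t\<close>. Minimizing the left
      factor gives the shortest coset representative.\<close>
    define P where "P v u \<longleftrightarrow> v \<in> lists S \<and> u \<in> lists {s, t} \<and> prod_w v \<otimes> prod_w u = g
      \<and> len (prod_w v) + length u = len g" for v u
    have inS: "u \<in> lists S" if "u \<in> lists {s, t}" for u using that t less.prems by auto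
    obtain v0 where v0: "v0 \<in> lists S" "length v0 = len (g \<otimes> t)" "prod_w v0 = g \<otimes> t"
      using len_word[of "g \<otimes> t"] g t S_carrier by (metis m_closed)
    have P0: "P v0 [t]" using t v0 g by (simp add: P_def S_carrier m_assoc S_square)
    obtain v u where P: "P v u" and min: "\<And>v' u'. P v' u' \<Longrightarrow> len (prod_w v) \<le> len (prod_w v')"
      using ex_has_least_nat[of "\<lambda>(v, u). P v u" "(v0, [t])" "\<lambda>(v, u). len (prod_w v)"] P0 by auto
    have vu: "v \<in> lists S" "u \<in> lists {s, t}" "u \<in> lists S" "prod_w v \<otimes> prod_w u = g"
        "len (prod_w v) + length u = len g"
      using P inS by (auto simp: P_def)
    have less_v: "len (prod_w v) < len g" using min[OF P0] v0 t by simp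
    \<comment> \<open>Otherwise \<open>r\<close> could be moved from \<open>v\<close> to the front
      of \<open>u\<close>, making the left factor shorter.\<close>
    have up: "len (prod_w v \<otimes> r) > len (prod_w v)" if r: "r \<in> {s, t}" for r
    proof (rule ccontr)
      assume neg: "\<not> ?thesis"
      have rS: "r \<in> S" using r t less.prems by auto
      then have eq: "len (prod_w v) = len (prod_w (v @ [r])) + 1"
        using len_mult_gen[of "prod_w v" r] neg vu by (auto simp: prod_w_append prod_w_S S_carrier)
      have "prod_w (v @ [r]) \<otimes> prod_w (r # u) = g"
        using vu rS by (simp add: prod_w_append prod_w_S S_carrier m_assoc)
          (metis S_carrier S_square m_assoc l_one prod_w_S)
      moreover have "v @ [r] \<in> lists S" "r # u \<in> lists {s, t}" using vu rS r by auto
      ultimately have "P (v @ [r]) (r # u)"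
        unfolding P_def using eq vu(5) by simp
      from min[OF this] eq show False by simp
    qed
    define a where "a = fire_word k v f"
    have a: "a r \<ge> 0" if "r \<in> {s, t}" for r
      unfolding a_def using less.hyps[of v r] less_v vu up[OF that] that t less.prems
      by (auto simp: g_def)
    have "fire_word k w = fire_word k (v @ u)"
      using vu less.prems by (intro equal_products) (auto simp: prod_w_append g_def)
    then have fw: "fire_word k w f = fire_word k u a" by (simp add: a_def)
    have us: "u @ [s] \<in> lists {s, t}" using vu by auto
    \<comment> \<open>As \<open>s\<close> lengthens \<open>g\<close>, the word
      \<open>u @ [s]\<close> is shortest among dihedral words for its element. So it has at most
      \<open>m s t\<close> letters if this is nonzero, and the Chebyshev coefficients below are
      nonnegative.\<close>
    have "length (u @ [s]) \<le> length u'" if "u' \<in> lists {s, t}" "prod_w u' = prod_w (u @ [s])" for u'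
    proof -
      have "prod_w v \<otimes> prod_w u' = g \<otimes> s"
        using vu less.prems that by (simp add: prod_w_append prod_w_S S_carrier flip: m_assoc)
      then have "len (g \<otimes> s) \<le> len (prod_w v) + length u'"
        using len_mult_le[of "prod_w v" u'] vu inS[OF that(1)] by (simp add: prod_w_S)
      then show ?thesis using vu(5) less.prems(3) by (simp add: g_def)
    qed
    from minimal_dihedral_word[OF less.prems(2) t(1) st us this]
    obtain x y where xy: "u @ [s] = alternating x y (Suc (length u))" "{x, y} = {s, t}"
        and n: "m s t \<noteq> 0 \<Longrightarrow> Suc (length u) \<le> m s t"
      by fastforce
    have xyS: "x \<in> S" "y \<in> S" "x \<noteq> y" "m x y = m s t"
      using xy(2) t less.prems st m_sym by (auto simp: doubleton_eq_iff)
    define n where "n = length u"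
    have u_alt: "u = alternating x y n" and s_alt: "s = (if even n then x else y)"
      using xy(1) unfolding alternating_Suc_right n_def by auto
    have "fire_word k u a s = cheb (k x y) (Suc n) * a x + cheb (k x y) n * a y"
      unfolding u_alt s_alt using xyS
      by (intro fire_alternating_next) (auto simp: k_self k_sym)
    also have "\<dots> \<ge> 0"
      using n xyS a xy(2) by (intro add_nonneg_nonneg mult_nonneg_nonneg cheb_nonneg) (auto simp: n_def)
    finally show ?thesis by (simp add: fw)
  qed
qed

section \<open>Reduced words and signs of roots\<close>

lemma reduced_positive:
  assumes "reduced_word W S (w @ [s])" and "\<And>x. x \<in> S \<Longrightarrow> f x \<ge> 0"
  shows "fire_word k w f s \<ge> 0"
proof -
  have w: "w \<in> lists S" "s \<in> S" "len (prod_w w \<otimes> s) = Suc (length w)"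
    using assms(1) prod_w_append[of w "[s]"] by (auto simp: reduced_word_iff S_carrier)
  then have "len (prod_w w \<otimes> s) > len (prod_w w)" using len_le[of w] by simp
  then show ?thesis using positive_root w assms(2) by blast
qed

text \<open>Here \<open>s\<close> lengthens the element of \<open>w @ [s]\<close>, so
  \<open>positive_root\<close> applies to that word; its last firing has negated the value at
  \<open>s\<close>.\<close>

lemma not_reduced_negative:
  assumes "reduced_word W S w" "s \<in> S" "\<not> reduced_word W S (w @ [s])"
    and "\<And>x. x \<in> S \<Longrightarrow> f x \<ge> 0"
  shows "fire_word k w f s \<le> 0"
proof -
  have w: "w \<in> lists S" "len (prod_w w) = length w" "len (prod_w w \<otimes> s) \<noteq> Suc (length w)"
    using assms(1-3) by (auto simp: reduced_word_iff prod_w_append S_carrier)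
  have ws: "w @ [s] \<in> lists S" "prod_w (w @ [s]) = prod_w w \<otimes> s"
    using w assms(2) by (auto simp: prod_w_append S_carrier)
  have "len (prod_w w) = len (prod_w w \<otimes> s) + 1"
    using len_mult_gen[of "prod_w w" s] w assms(2) by (auto simp: prod_w_S)
  moreover have "prod_w (w @ [s]) \<otimes> s = prod_w w"
    using w assms(2) by (simp add: ws prod_w_S S_carrier m_assoc S_square)
  ultimately have "fire_word k (w @ [s]) f s \<ge> 0"
    using positive_root[OF ws(1) assms(2) _ assms(4)] by (simp add: ws(2))
  then show ?thesis using assms(2) by (simp add: fire_def k_self)
qed

end


section \<open>Words with intervening neighbours\<close>

text \<open>An absent letter gets the value \<open>length w\<close> and so ranks after all letters
  that occur.\<close>

definition first_occ :: "'a list \<Rightarrow> 'a \<Rightarrow> nat" where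
  "first_occ w x = length (takeWhile (\<lambda>y. y \<noteq> x) w)"

lemma first_occ_Cons: "first_occ (s # w) x = (if s = x then 0 else Suc (first_occ w x))"
  by (simp add: first_occ_def)

lemma first_occ_less_length: "first_occ w x < first_occ w y \<Longrightarrow> first_occ w x < length w"
  using length_takeWhile_le[of "\<lambda>z. z \<noteq> y" w] by (simp add: first_occ_def)

lemma nth_first_occ: "first_occ w x < length w \<Longrightarrow> w ! first_occ w x = x"
  unfolding first_occ_def using nth_length_takeWhile[of "\<lambda>z. z \<noteq> x" w] by simp

lemma nth_before_first_occ: "i < first_occ w x \<Longrightarrow> w ! i \<noteq> x"
  using nth_mem[of i "takeWhile (\<lambda>y. y \<noteq> x) w"] takeWhile_nth[of i "\<lambda>y. y \<noteq> x" w]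
  by (auto simp: first_occ_def dest: set_takeWhileD)

lemma intervening_neighbours_infix:
  assumes "intervening_neighbours W S (a @ b @ c)"
  shows "intervening_neighbours W S b"
  unfolding intervening_neighbours_def
proof (intro allI impI, elim conjE)
  fix i j t
  assume ij: "i < j" "j < length b" "b ! i = b ! j" and t: "(b ! i, t) \<in> cox_edges W S"
  let ?l = "length a"
  have nth: "(a @ b @ c) ! (?l + n) = b ! n" if "n < length b" for n
    using that by (simp add: nth_append)
  have "\<exists>n. ?l + i < n \<and> n < ?l + j \<and> (a @ b @ c) ! n = t"
  proof -
    have "?l + i < ?l + j \<and> ?l + j < length (a @ b @ c) \<and> (a @ b @ c) ! (?l + i) = (a @ b @ c) ! (?l + j)"
      using ij nth[of i] nth[of j] by simp
    moreover have "((a @ b @ c) ! (?l + i), t) \<in> cox_edges W S" using nth[of i] ij t by simp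
    ultimately show ?thesis using assms unfolding intervening_neighbours_def by blast
  qed
  then obtain n where n: "?l + i < n" "n < ?l + j" "(a @ b @ c) ! n = t" by blast
  then have "b ! (n - ?l) = t" using nth[of "n - ?l"] ij by simp
  then show "\<exists>n. i < n \<and> n < j \<and> b ! n = t"
    using n by (intro exI[of _ "n - ?l"]) auto
qed

text \<open>Turns \<open>s\<close> into a sink. Distinct non-adjacent generators may be affected
  too; their weight \<open>k\<close> is 0.\<close>

definition flip :: "'a \<Rightarrow> ('a \<Rightarrow> 'a \<Rightarrow> bool) \<Rightarrow> 'a \<Rightarrow> 'a \<Rightarrow> bool" where
  "flip s r = (\<lambda>x y. x \<noteq> s \<and> (y = s \<or> r x y))"

context coxeter
begin

lemma fire_word_cong:
  assumes "w \<in> lists S" "\<And>x. x \<in> S \<Longrightarrow> f x = g x" "t \<in> S"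
  shows "fire_word k w f t = fire_word k w g t"
  using assms(1,2)
proof (induction w arbitrary: f g rule: list.induct)
  case Nil
  then show ?case using assms(3) by simp
next
  case (Cons s w)
  then have "f s = g s" "w \<in> lists S" by auto
  then have "fire_word k w (fire k s f) t = fire_word k w (fire k s g) t"
    using Cons.prems(2) by (intro Cons.IH) (auto simp: fire_def)
  then show ?case by simp
qed

text \<open>\<open>r x y\<close> says that the edge between \<open>x\<close> and \<open>y\<close> points from \<open>x\<close> to \<open>y\<close>.\<close>

fun source_sequence :: "('a \<Rightarrow> 'a \<Rightarrow> bool) \<Rightarrow> 'a list \<Rightarrow> bool" where
  "source_sequence r [] = True"
| "source_sequence r (s # w) =
     ((\<forall>y. (s, y) \<in> cox_edges W S \<longrightarrow> r s y \<and> \<not> r y s) \<and> source_sequence (flip s r) w)"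

text \<open>Invariant: each edge points away from the letter that occurs first in the remaining
  word. Once \<open>s\<close> is consumed, it can recur only after all its neighbours, so reversing
  the arrows at \<open>s\<close> restores the invariant.\<close>

lemma intervening_source_sequence:
  assumes "intervening_neighbours W S w"
    and "\<And>x y. (x, y) \<in> cox_edges W S \<Longrightarrow> first_occ w x < first_occ w y \<Longrightarrow> r x y \<and> \<not> r y x"
  shows "source_sequence r w"
  using assms
proof (induction w arbitrary: r)
  case (Cons s w)
  have "flip s r x y \<and> \<not> flip s r y x"
    if e: "(x, y) \<in> cox_edges W S" and less: "first_occ w x < first_occ w y" for x y
  proof (cases "x = s")
    case True
    \<comment> \<open>Impossible case: \<open>s\<close> would recur before its neighbour
      \<open>y\<close> occurs.\<close>
    define n where "n = first_occ w s"
    have n: "n < length w" "w ! n = s"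
      using first_occ_less_length[OF less] nth_first_occ True by (auto simp: n_def)
    obtain i where "0 < i" "i < Suc n" "(s # w) ! i = y"
      using Cons.prems(1)[unfolded intervening_neighbours_def, rule_format, of 0 "Suc n" y] n e True
      by auto
    then have "i - 1 < first_occ w y" "w ! (i - 1) = y" using less True by (auto simp: n_def nth_Cons')
    then show ?thesis using nth_before_first_occ by metis
  next
    case False
    then show ?thesis using Cons.prems(2)[OF e] less
      by (cases "y = s") (auto simp: flip_def first_occ_Cons)
  qed
  moreover have "intervening_neighbours W S w"
    using intervening_neighbours_infix[of W S "[s]" w "[]"] Cons.prems(1) by simp
  ultimately have "source_sequence (flip s r) w" using Cons.IH by blast
  moreover have "r s y \<and> \<not> r y s" if "(s, y) \<in> cox_edges W S" for y
    using Cons.prems(2)[OF that] that by (auto simp: first_occ_Cons cox_edges_def)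
  ultimately show ?case by simp
qed simp

text \<open>A positive root made negative by the reflection in \<open>s\<close> is a multiple of
  \<alpha>_s: nonnegative functionals vanishing at \<open>s\<close> are fixed by firing
  \<open>s\<close>, so the two sign conditions force the value 0 on them.\<close>

lemma fire_word_split:
  assumes s: "s \<in> S"
    and pos: "\<And>f. (\<And>x. x \<in> S \<Longrightarrow> f x \<ge> 0) \<Longrightarrow> fire_word k w f t \<ge> 0"
    and neg: "\<And>f. (\<And>x. x \<in> S \<Longrightarrow> f x \<ge> 0) \<Longrightarrow> fire_word k w (fire k s f) t \<le> 0"
  obtains c where "c \<ge> 0" "\<And>f. fire_word k w f t = c * f s"
proof
  define e where "e = (\<lambda>x. if x = s then 1 else 0 :: real)"
  show "fire_word k w e t \<ge> 0" by (rule pos) (simp add: e_def)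
  have zero: "fire_word k w f t = 0" if "\<And>x. f x \<ge> 0" "f s = 0" for f
  proof -
    have "fire k s f = f" using that by (simp add: fire_def)
    then show ?thesis using pos[of f] neg[of f] that by force
  qed
  fix f :: "'a \<Rightarrow> real"
  define h where "h = (\<lambda>x. if x = s then 0 else f x)"
  have "h = (\<lambda>x. max 0 (h x) - max 0 (- h x))" by (auto simp: max_def fun_eq_iff)
  then have "fire_word k w h t = fire_word k w (\<lambda>x. max 0 (h x)) t - fire_word k w (\<lambda>x. max 0 (- h x)) t"
    using fire_word_diff by metis
  also have "\<dots> = 0" using zero[of "\<lambda>x. max 0 (h x)"] zero[of "\<lambda>x. max 0 (- h x)"]
    by (simp add: h_def)
  finally have "fire_word k w h t = 0" .
  moreover have "f = (\<lambda>x. h x + f s * e x)" by (auto simp: h_def e_def)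
  ultimately show "fire_word k w f t = fire_word k w e t * f s"
    using fire_word_add[of k w h "\<lambda>x. f s * e x" t] by (simp add: fire_word_scale)
qed

section \<open>The Euler form along a source sequence\<close>

context
  fixes \<delta> :: "'a \<Rightarrow> real" and D T :: "'a set"
  assumes D: "finite D" "D \<subseteq> S" "T \<subseteq> D"
    and \<delta>_pos: "\<And>x. x \<in> T \<Longrightarrow> \<delta> x > 0"
    and \<delta>_sub: "\<And>x. x \<in> T \<Longrightarrow> 2 * \<delta> x \<le> (\<Sum>y\<in>D - {x}. k y x * \<delta> y)"
begin

text \<open>This is \<open>E\<^sub>r(\<delta>, \<alpha>\<^sub>x)\<close>.\<close>

definition euler :: "('a \<Rightarrow> 'a \<Rightarrow> bool) \<Rightarrow> 'a \<Rightarrow> real" where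
  "euler r x = \<delta> x - (\<Sum>y\<in>D - {x}. if r y x then k y x * \<delta> y else 0)"

lemma euler_source:
  assumes "s \<in> S" "\<And>y. (s, y) \<in> cox_edges W S \<Longrightarrow> \<not> r y s"
  shows "euler r s = \<delta> s"
proof -
  have "k y s = 0" if "y \<in> D - {s}" "r y s" for y
    using that assms D edge_sym k_non_edge by blast
  then have "(\<Sum>y\<in>D - {s}. if r y s then k y s * \<delta> y else 0) = 0"
    by (intro sum.neutral) auto
  then show ?thesis by (simp add: euler_def)
qed

text \<open>After the flip all arrows at \<open>s\<close> enter it, so the sum in
  \<open>euler\<close> is the full one, which is at least \<open>2 * \<delta> s\<close>.\<close>

lemma euler_flip_sink:
  assumes "s \<in> T"
  shows "euler (flip s r) s \<le> - \<delta> s"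
proof -
  have "(\<Sum>y\<in>D - {s}. if flip s r y s then k y s * \<delta> y else 0) = (\<Sum>y\<in>D - {s}. k y s * \<delta> y)"
    by (rule sum.cong) (auto simp: flip_def)
  then show ?thesis using \<delta>_sub[OF assms] by (simp add: euler_def)
qed

text \<open>Away from \<open>s\<close>, firing adds the term \<open>k s x * \<delta> s\<close> that
  the flip removes from the sum. At \<open>s\<close> the value passes from \<open>\<delta> s\<close>
  to \<open>- \<delta> s\<close>, and the correction is the defect there: the full sum minus
  \<open>2 * \<delta> s\<close>.\<close>

lemma fire_euler:
  assumes s: "s \<in> T" and src: "\<And>y. (s, y) \<in> cox_edges W S \<Longrightarrow> r s y \<and> \<not> r y s" and x: "x \<in> S"
  shows "fire k s (euler r) x =
    euler (flip s r) x + (- \<delta> s - euler (flip s r) s) * (if x = s then 1 else 0)"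
proof -
  have sS: "s \<in> S" "s \<in> D" using s D by auto
  have es: "euler r s = \<delta> s" using euler_source src sS by blast
  show ?thesis
  proof (cases "x = s")
    case True
    then show ?thesis by (simp add: fire_def es k_self sS)
  next
    case False
    have "(\<Sum>y\<in>D - {x}. if r y x then k y x * \<delta> y else 0) =
        (if r s x then k s x * \<delta> s else 0) + (\<Sum>y\<in>D - {x} - {s}. if r y x then k y x * \<delta> y else 0)"
      using False sS D by (intro sum.remove) auto
    moreover have "(if r s x then k s x * \<delta> s else 0) = k s x * \<delta> s"
      using src k_non_edge[of s x] sS x False by auto
    moreover have "(\<Sum>y\<in>D - {x}. if flip s r y x then k y x * \<delta> y else 0) =
        (if flip s r s x then k s x * \<delta> s else 0)
        + (\<Sum>y\<in>D - {x} - {s}. if flip s r y x then k y x * \<delta> y else 0)"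
      using False sS D by (intro sum.remove) auto
    moreover have "(\<Sum>y\<in>D - {x} - {s}. if flip s r y x then k y x * \<delta> y else 0)
        = (\<Sum>y\<in>D - {x} - {s}. if r y x then k y x * \<delta> y else 0)"
      using False by (intro sum.cong) (auto simp: flip_def)
    moreover have "\<not> flip s r s x" by (simp add: flip_def)
    moreover have "fire k s (euler r) x = euler r x + k s x * \<delta> s"
      by (simp add: fire_def es)
    ultimately show ?thesis using False by (simp add: euler_def[of _ x])
  qed
qed

text \<open>The third assumption concerns the coordinate of the moving root at the fired letter.
  Each firing contributes the nonnegative defect times this coordinate, and at the end
  \<open>t\<close> is a source with value \<open>\<delta> t\<close>.\<close>

lemma euler_source_sequence:
  assumes "source_sequence r (w @ [t])" "set (w @ [t]) \<subseteq> T"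
    and "\<And>a x b. w = a @ x # b \<Longrightarrow> fire_word k b (\<lambda>y. if y = x then 1 else 0) t \<ge> 0"
  shows "fire_word k w (euler r) t \<ge> \<delta> t"
  using assms
proof (induction w arbitrary: r)
  case Nil
  then have "t \<in> S" "\<And>y. (t, y) \<in> cox_edges W S \<Longrightarrow> \<not> r y t" using D by auto
  then have "euler r t = \<delta> t" by (rule euler_source)
  then show ?case by simp
next
  case (Cons s w)
  define e where "e = (\<lambda>x. if x = s then 1 else 0 :: real)"
  define c where "c = - \<delta> s - euler (flip s r) s"
  have c: "c \<ge> 0" using euler_flip_sink[of s r] Cons.prems(2) by (simp add: c_def)
  have w: "w \<in> lists S" "t \<in> S" "s \<in> T" using Cons.prems(2) D by auto
  have "fire_word k w (fire k s (euler r)) t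
      = fire_word k w (\<lambda>x. euler (flip s r) x + c * e x) t"
  proof (rule fire_word_cong[OF w(1) _ w(2)])
    show "fire k s (euler r) x = euler (flip s r) x + c * e x" if "x \<in> S" for x
      unfolding c_def e_def by (rule fire_euler[OF w(3) _ that]) (use Cons.prems(1) in auto)
  qed
  also have "\<dots> = fire_word k w (euler (flip s r)) t + c * fire_word k w e t"
    by (simp add: fire_word_add fire_word_scale)
  also have "\<dots> \<ge> \<delta> t + c * 0"
  proof (intro add_mono mult_left_mono c)
    show "fire_word k w (euler (flip s r)) t \<ge> \<delta> t"
    proof (rule Cons.IH)
      show "fire_word k b (\<lambda>y. if y = x then 1 else 0) t \<ge> 0" if "w = a @ x # b" for a x b
        using Cons.prems(3)[of "s # a" x b] that by simp
    qed (use Cons.prems in auto)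
    show "fire_word k w e t \<ge> 0" using Cons.prems(3)[of "[]" s w] by (simp add: e_def)
  qed
  finally show ?case by simp
qed

text \<open>Otherwise v \<alpha>_t is a positive root made negative by \<open>s\<close>, hence
  \<open>c\<close> times \<alpha>_s with \<open>c \<ge> 0\<close>. After the flip of
  \<open>s\<close> its Euler value is at least \<open>\<delta> t\<close>, which is positive, by the
  source sequence, but also \<open>c\<close> times the nonpositive value at the sink
  \<open>s\<close>.\<close>

lemma intervening_reduced_step:
  assumes "set (s # v @ [t]) \<subseteq> T" "intervening_neighbours W S (s # v @ [t])"
    and shorter: "\<And>a b c. s # v @ [t] = a @ b @ c \<Longrightarrow> a @ c \<noteq> [] \<Longrightarrow> reduced_word W S b"
  shows "reduced_word W S (s # v @ [t])"
proof (rule ccontr)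
  assume neg: "\<not> ?thesis"
  let ?w = "s # v @ [t]"
  have st: "s \<in> T" "t \<in> T" "s \<in> S" "t \<in> S" using assms(1) D by auto
  have pos: "fire_word k b f t \<ge> 0" if "s # v = a @ b" "a \<noteq> []" "\<And>x. x \<in> S \<Longrightarrow> f x \<ge> 0" for a b f
    using shorter[of a "b @ [t]" "[]"] that by (intro reduced_positive) auto
  obtain c where c: "c \<ge> 0" "\<And>f. fire_word k v f t = c * f s"
  proof (rule fire_word_split[OF st(3)])
    show "fire_word k v f t \<ge> 0" if "\<And>x. x \<in> S \<Longrightarrow> f x \<ge> 0" for f
      using pos[of "[s]" v f] that by simp
    show "fire_word k v (fire k s f) t \<le> 0" if "\<And>x. x \<in> S \<Longrightarrow> f x \<ge> 0" for f
      using not_reduced_negative[of "s # v" t f] shorter[of "[]" "s # v" "[t]"] neg st that by simp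
  qed (rule that)
  define r where "r x y \<longleftrightarrow> first_occ ?w x < first_occ ?w y" for x y
  have "source_sequence r ?w"
    by (rule intervening_source_sequence[OF assms(2)], unfold r_def) linarith
  then have "source_sequence (flip s r) (v @ [t])" by simp
  then have "fire_word k v (euler (flip s r)) t \<ge> \<delta> t"
  proof (rule euler_source_sequence)
    show "fire_word k b (\<lambda>y. if y = x then 1 else 0) t \<ge> 0" if "v = a @ x # b" for a x b
      using that by (intro pos[of "s # a @ [x]"]) auto
  qed (use assms(1) in auto)
  moreover have "euler (flip s r) s \<le> 0"
    using euler_flip_sink[OF st(1), of r] \<delta>_pos[OF st(1)] by simp
  then have "fire_word k v (euler (flip s r)) t \<le> 0"
    using c by (simp add: mult_nonneg_nonpos)
  ultimately show False using \<delta>_pos[OF st(2)] by simp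
qed

lemma intervening_reduced:
  assumes "set w \<subseteq> T" "intervening_neighbours W S w"
  shows "reduced_word W S w"
  using assms
proof (induction "length w" arbitrary: w rule: less_induct)
  case less
  have wS: "w \<in> lists S" using less.prems D by auto
  show ?case
  proof (cases "length w \<le> 1")
    case True
    obtain v where v: "v \<in> lists S" "length v = len (prod_w w)" "prod_w v = prod_w w"
      using len_word[OF prod_w_S[OF wS]] by metis
    \<comment> \<open>Parity excludes that a single letter represents the identity.\<close>
    then have "even (length v) = even (length w)" using equal_products(2) wS by blast
    then have "length v = length w"
      using True v len_le[OF wS] by (metis One_nat_def even_zero le_Suc_eq le_zero_eq odd_one)
    then show ?thesis using v wS by (simp add: reduced_word_iff)
  next
    case False
    then obtain s w' where sw: "w = s # w'" "w' \<noteq> []" by (cases w) auto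
    then obtain v t where w: "w = s # v @ [t]" by (metis rev_exhaust)
    have "reduced_word W S b" if "w = a @ b @ c" "a @ c \<noteq> []" for a b c
    proof (rule less.hyps)
      show "length b < length w" using that by auto
      show "set b \<subseteq> T" using that less.prems by auto
      show "intervening_neighbours W S b"
        using that less.prems intervening_neighbours_infix by blast
    qed
    then show ?thesis using intervening_reduced_step[of s v t] less.prems unfolding w by blast
  qed
qed

end

end


section \<open>Subharmonic vectors\<close>

text \<open>Tychonoff. Pinning the values outside \<open>D\<close> to 0 lets functions on the whole
  type serve as vectors indexed by \<open>D\<close>.\<close>

lemma compact_box_function: "compact {v :: 'a \<Rightarrow> real. \<forall>x. v x \<in> (if x \<in> D then {-1..1} else {0})}"
proof -
  have "compactin (product_topology (\<lambda>_. euclidean) UNIV)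
      (PiE UNIV (\<lambda>x::'a. if x \<in> D then {-1..1} else {0 :: real}))"
    by (subst compactin_PiE) auto
  then show ?thesis by (simp add: euclidean_product_topology PiE_def Pi_def)
qed

text \<open>
  The minimizer of the quadratic form on the unit sphere can be taken nonnegative because
  passing to absolute values does not increase a form with nonpositive off-diagonal entries.
\<close>

lemma bottom_eigenvector:
  fixes A :: "'a \<Rightarrow> 'a \<Rightarrow> real"
  assumes D: "finite D" "D \<noteq> {}"
    and sym: "\<And>x y. x \<in> D \<Longrightarrow> y \<in> D \<Longrightarrow> A x y = A y x"
    and off: "\<And>x y. x \<in> D \<Longrightarrow> y \<in> D \<Longrightarrow> x \<noteq> y \<Longrightarrow> A x y \<le> 0"
  obtains p \<mu> where "\<And>x. p x \<ge> 0" "(\<Sum>x\<in>D. (p x)\<^sup>2) = 1"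
    "\<And>x. x \<in> D \<Longrightarrow> (\<Sum>y\<in>D. A x y * p y) = \<mu> * p x"
    "\<And>v. (\<Sum>x\<in>D. \<Sum>y\<in>D. A x y * v x * v y) \<ge> \<mu> * (\<Sum>x\<in>D. (v x)\<^sup>2)"
proof -
  define q where "q v = (\<Sum>x\<in>D. \<Sum>y\<in>D. A x y * v x * v y)" for v
  define n where "n v = (\<Sum>x\<in>D. (v x)\<^sup>2)" for v :: "'a \<Rightarrow> real"
  define B where "B = {v :: 'a \<Rightarrow> real. \<forall>x. v x \<in> (if x \<in> D then {-1..1} else {0})}"
  define C where "C = B \<inter> {v. n v = 1}"
  have "continuous_on UNIV n" unfolding n_def by (intro continuous_intros) simp
  then have "closed {v. n v = 1}" by (intro closed_Collect_eq) auto
  then have "compact C" unfolding C_def B_def by (intro compact_Int_closed compact_box_function)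
  moreover have "continuous_on C q" unfolding q_def
    by (intro continuous_intros) (auto intro: continuous_on_subset[OF continuous_on_product_coordinates])
  moreover obtain d where d: "d \<in> D" using D by auto
  have "(\<lambda>x. if x = d then 1 else 0) \<in> C"
    using d D by (auto simp: C_def B_def n_def if_distrib[of "\<lambda>x. x\<^sup>2"] cong: if_cong)
  then have "C \<noteq> {}" by blast
  ultimately obtain v0 where v0: "v0 \<in> C" "\<And>v. v \<in> C \<Longrightarrow> q v0 \<le> q v"
    using continuous_attains_inf[of C q] by blast
  define \<mu> where "\<mu> = q v0"
  define p where "p x = \<bar>v0 x\<bar>" for x
  have scale: "q v \<ge> \<mu> * n v" for v
  proof (cases "n v = 0")
    case True
    then have "v x = 0" if "x \<in> D" for x
      using that D by (auto simp: n_def sum_nonneg_eq_0_iff)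
    then show ?thesis using True by (simp add: q_def)
  next
    case False
    then have pos: "n v > 0" by (simp add: n_def sum_nonneg less_le)
    define c where "c = 1 / sqrt (n v)"
    define u where "u x = (if x \<in> D then c * v x else 0)" for x
    have c: "c\<^sup>2 * n v = 1" using pos by (simp add: c_def power_divide)
    have "n u = c\<^sup>2 * n v" unfolding n_def sum_distrib_left
      by (intro sum.cong) (auto simp: u_def power_mult_distrib)
    then have nu: "n u = 1" using c by simp
    have "\<bar>u x\<bar> \<le> 1" if "x \<in> D" for x
    proof -
      have "(u x)\<^sup>2 \<le> n u" unfolding n_def using that D by (intro member_le_sum) auto
      then show ?thesis using nu by (simp add: abs_square_le_1)
    qed
    then have "u \<in> C" using nu by (auto simp: C_def B_def u_def abs_le_iff minus_le_iff)
    then have "\<mu> \<le> q u" using v0 by (simp add: \<mu>_def)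
    also have "q u = c\<^sup>2 * q v" unfolding q_def sum_distrib_left
      by (intro sum.cong) (auto simp: u_def power2_eq_square algebra_simps)
    finally have "\<mu> * n v \<le> c\<^sup>2 * q v * n v" using pos by (intro mult_right_mono) auto
    also have "\<dots> = q v" using c by (simp add: algebra_simps)
    finally show ?thesis .
  qed
  have np: "n p = 1" using v0(1) by (simp add: C_def n_def p_def)
  have "q p \<le> q v0" unfolding q_def
  proof (intro sum_mono)
    fix x y assume "x \<in> D" "y \<in> D"
    then show "A x y * p x * p y \<le> A x y * v0 x * v0 y"
      using off[of x y] abs_ge_self[of "v0 x * v0 y"]
      by (cases "x = y") (auto simp: p_def mult.assoc abs_mult[symmetric] intro: mult_left_mono_neg)
  qed
  then have qp: "q p = \<mu>" using scale[of p] np by (simp add: \<mu>_def)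
  have eigen: "(\<Sum>y\<in>D. A x y * p y) = \<mu> * p x" if x: "x \<in> D" for x
  proof -
    define b where "b = (\<Sum>y\<in>D. A x y * p y) - \<mu> * p x"
    define e where "e = (\<lambda>y. if y = x then 1 else 0 :: real)"
    \<comment> \<open>Apply \<open>scale\<close> to \<open>p + t * e\<close>. It is an equality at
      \<open>t = 0\<close>, so the constant terms cancel and a polynomial with linear coefficient
      \<open>2 * b\<close> remains.\<close>
    have key: "2 * t * b + t\<^sup>2 * (A x x - \<mu>) \<ge> 0" for t
    proof -
      have e1: "(\<Sum>y\<in>D. g y * e y) = g x" for g
        using x D by (simp add: e_def if_distrib[of "\<lambda>z. g _ * z"] cong: if_cong)
      have "n (\<lambda>y. p y + t * e y) = (\<Sum>y\<in>D. (p y)\<^sup>2 + (2 * t * p y) * e y + (t\<^sup>2 * e y) * e y)"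
        unfolding n_def by (intro sum.cong) (auto simp: power2_eq_square algebra_simps)
      also have "\<dots> = 1 + 2 * t * p x + t\<^sup>2"
        unfolding sum.distrib e1 using np by (simp add: n_def e_def)
      finally have n: "n (\<lambda>y. p y + t * e y) = 1 + 2 * t * p x + t\<^sup>2" .
      have "q (\<lambda>y. p y + t * e y) = (\<Sum>z\<in>D. (\<Sum>y\<in>D. A z y * p z * p y)
          + (t * (\<Sum>y\<in>D. A z y * p y)) * e z + t * p z * (\<Sum>y\<in>D. A z y * e y)
          + (t\<^sup>2 * (\<Sum>y\<in>D. A z y * e y)) * e z)"
        unfolding q_def
      proof (rule sum.cong)
        fix z
        have "(\<Sum>y\<in>D. A z y * (p z + t * e z) * (p y + t * e y)) =
            (\<Sum>y\<in>D. A z y * p z * p y + (t * e z) * (A z y * p y)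
              + (t * p z) * (A z y * e y) + (t\<^sup>2 * e z) * (A z y * e y))"
          by (intro sum.cong) (auto simp: power2_eq_square algebra_simps)
        then show "(\<Sum>y\<in>D. A z y * (p z + t * e z) * (p y + t * e y)) =
            (\<Sum>y\<in>D. A z y * p z * p y) + (t * (\<Sum>y\<in>D. A z y * p y)) * e z
              + t * p z * (\<Sum>y\<in>D. A z y * e y) + (t\<^sup>2 * (\<Sum>y\<in>D. A z y * e y)) * e z"
          unfolding sum.distrib sum_distrib_left[symmetric] by (simp add: mult_ac)
      qed simp
      also have "\<dots> = q p + t * (\<Sum>y\<in>D. A x y * p y) + t * (\<Sum>z\<in>D. A z x * p z) + t\<^sup>2 * A x x"
        unfolding sum.distrib e1 by (simp add: q_def sum_distrib_left mult_ac)
      also have "(\<Sum>z\<in>D. A z x * p z) = (\<Sum>y\<in>D. A x y * p y)"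
        using x sym by (intro sum.cong) auto
      finally have "q (\<lambda>y. p y + t * e y) = \<mu> + 2 * t * (\<Sum>y\<in>D. A x y * p y) + t\<^sup>2 * A x x"
        using qp by simp
      with scale[of "\<lambda>y. p y + t * e y"] n show ?thesis
        by (simp add: b_def algebra_simps)
    qed
    have "b = 0"
    proof (rule ccontr)
      assume "b \<noteq> 0"
      \<comment> \<open>A positive bound for the quadratic coefficient: at
        \<open>t = - b / c\<close> the polynomial is at most \<open>- b\<^sup>2 / c\<close>, hence
        negative.\<close>
      define c where "c = \<bar>A x x - \<mu>\<bar> + 1"
      have c: "c > 0" "A x x - \<mu> \<le> c" by (auto simp: c_def)
      have "2 * (- b / c) * b + (- b / c)\<^sup>2 * c \<ge> 2 * (- b / c) * b + (- b / c)\<^sup>2 * (A x x - \<mu>)"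
        using c by (intro add_left_mono mult_left_mono) auto
      also have "2 * (- b / c) * b + (- b / c)\<^sup>2 * (A x x - \<mu>) \<ge> 0" by (rule key)
      finally have "2 * (- b / c) * b + (- b / c)\<^sup>2 * c \<ge> 0" .
      moreover have "2 * (- b / c) * b + (- b / c)\<^sup>2 * c = - b\<^sup>2 / c"
        using c by (simp add: power2_eq_square field_simps)
      moreover have "b\<^sup>2 / c > 0" using \<open>b \<noteq> 0\<close> c by simp
      ultimately show False by linarith
    qed
    then show ?thesis by (simp add: b_def)
  qed
  show thesis
    using that[of p \<mu>] np eigen scale by (simp add: p_def n_def q_def)
qed

text \<open>Tarski's fixed point argument: \<open>h\<close> is monotone because the off-diagonal
  weights are nonnegative, and the supersolution \<open>p\<close> bounds the set \<open>F\<close> of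
  subsolutions. The supremum \<open>v\<close> satisfies \<open>v \<le> h v\<close>, so
  \<open>h v\<close> is again in \<open>F\<close> and at most \<open>v\<close>.\<close>

lemma largest_subsolution:
  fixes K :: "'a \<Rightarrow> 'a \<Rightarrow> real"
  assumes K: "\<And>x y. x \<in> D \<Longrightarrow> y \<in> D - {x} \<Longrightarrow> K y x \<ge> 0"
    and b: "\<And>x. x \<in> D \<Longrightarrow> b x \<ge> 0" and p: "\<And>x. x \<in> D \<Longrightarrow> p x \<ge> 0"
    and sup: "\<And>x. x \<in> D \<Longrightarrow> (\<Sum>y\<in>D - {x}. K y x * p y) + b x \<le> 2 * p x"
  obtains v where "\<And>x. x \<in> D \<Longrightarrow> v x \<ge> 0"
    "\<And>x. x \<in> D \<Longrightarrow> 2 * v x = (\<Sum>y\<in>D - {x}. K y x * v y) + b x"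
proof -
  define h where "h f x = ((\<Sum>y\<in>D - {x}. K y x * f y) + b x) / 2" for f x
  have mono: "h f x \<le> h g x" if "x \<in> D" "\<And>y. y \<in> D \<Longrightarrow> f y \<le> g y" for f g x
    unfolding h_def using that K
    by (intro divide_right_mono add_mono sum_mono mult_left_mono) auto
  define F where "F = {f. \<forall>x\<in>D. 0 \<le> f x \<and> f x \<le> p x \<and> f x \<le> h f x}"
  define v where "v x = (SUP f\<in>F. f x)" for x
  have hp: "h p x \<le> p x" if "x \<in> D" for x using sup[OF that] by (simp add: h_def)
  have F0: "(\<lambda>x. 0) \<in> F" using p b by (auto simp: F_def h_def)
  have upper: "f x \<le> v x" if "x \<in> D" "f \<in> F" for f x
    unfolding v_def by (rule cSUP_upper[OF that(2)], rule bdd_aboveI[of _ "p x"]) (use that in \<open>auto simp: F_def\<close>)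
  have least: "v x \<le> c" if "\<And>f. f \<in> F \<Longrightarrow> f x \<le> c" for x c
    unfolding v_def using F0 that by (intro cSUP_least) auto
  have v0: "v x \<ge> 0" if "x \<in> D" for x using upper[OF that F0] .
  have vp: "v x \<le> p x" if "x \<in> D" for x by (rule least) (use that in \<open>auto simp: F_def\<close>)
  have vh: "v x \<le> h v x" if "x \<in> D" for x
  proof (rule least)
    fix f assume "f \<in> F"
    then have "f x \<le> h f x" using that by (simp add: F_def)
    also have "\<dots> \<le> h v x" using upper \<open>f \<in> F\<close> that by (intro mono) auto
    finally show "f x \<le> h v x" .
  qed
  have "h v \<in> F"
    unfolding F_def
  proof (clarify, intro conjI)
    fix x assume x: "x \<in> D"
    show "0 \<le> h v x" using v0[OF x] vh[OF x] by simp
    show "h v x \<le> p x" using mono[OF x, of v p] vp hp[OF x] by force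
    show "h v x \<le> h (h v) x" using x vh by (intro mono) auto
  qed
  then have "v x = h v x" if "x \<in> D" for x using upper[OF that] vh[OF that] by force
  then have "2 * v x = (\<Sum>y\<in>D - {x}. K y x * v y) + b x" if "x \<in> D" for x
    using that by (simp add: h_def field_simps)
  then show thesis using that v0 by blast
qed

section \<open>Connected sets of generators\<close>

context coxeter
begin

text \<open>Connectedness of the induced subgraph, phrased without paths to fit the zero set in
  \<open>supersolution_positive\<close>.\<close>

definition connected_in :: "'a set \<Rightarrow> bool" where
  "connected_in D \<longleftrightarrow> (\<forall>A\<subseteq>D. A \<noteq> {} \<longrightarrow>
     (\<forall>x\<in>A. \<forall>y\<in>D. (x, y) \<in> cox_edges W S \<longrightarrow> y \<in> A) \<longrightarrow> A = D)"

lemma connected_in_insert: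
  assumes "connected_in D" "x \<in> D" "(x, y) \<in> cox_edges W S"
  shows "connected_in (insert y D)"
  unfolding connected_in_def
proof (intro allI impI)
  fix A assume A: "A \<subseteq> insert y D" "A \<noteq> {}"
    "\<forall>u\<in>A. \<forall>v\<in>insert y D. (u, v) \<in> cox_edges W S \<longrightarrow> v \<in> A"
  have "A \<inter> D \<noteq> {}" using A assms(2) edge_sym[OF assms(3)] by blast
  moreover have "\<forall>u\<in>A \<inter> D. \<forall>v\<in>D. (u, v) \<in> cox_edges W S \<longrightarrow> v \<in> A \<inter> D" using A(3) by blast
  ultimately have "A \<inter> D = D" using assms(1) unfolding connected_in_def by (metis inf_le2)
  then show "A = insert y D" using A assms(2,3) by blast
qed

text \<open>The eigenvector argument needs a finite set even if \<open>S\<close> is infinite.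
  Letters are added one by one, each with a path from the set built so far.\<close>

lemma finite_connected_superset:
  assumes "coxeter_irreducible W S" "finite T" "T \<subseteq> S" "T \<noteq> {}"
  obtains D where "finite D" "T \<subseteq> D" "D \<subseteq> S" "connected_in D"
proof -
  have "\<exists>D. finite D \<and> T \<subseteq> D \<and> D \<subseteq> S \<and> connected_in D"
    using assms(2,4,3)
  proof (induction rule: finite_ne_induct)
    case (singleton x)
    have "connected_in {x}" unfolding connected_in_def by blast
    then show ?case using singleton by blast
  next
    case (insert x T)
    then obtain D where D: "finite D" "T \<subseteq> D" "D \<subseteq> S" "connected_in D" by auto
    obtain d where d: "d \<in> D" "d \<in> S" using insert D by auto
    have "(d, x) \<in> (cox_edges W S)\<^sup>*"
      using assms(1) d insert.prems by (auto simp: coxeter_irreducible_def)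
    then have "\<exists>D'. finite D' \<and> insert x D \<subseteq> D' \<and> D' \<subseteq> S \<and> connected_in D'"
    proof induction
      case base
      then show ?case using D d by (intro exI[of _ D]) auto
    next
      case (step y z)
      then obtain D' where D': "finite D'" "insert y D \<subseteq> D'" "D' \<subseteq> S" "connected_in D'" by blast
      then have "connected_in (insert z D')" using step(2) by (intro connected_in_insert[of D' y]) auto
      moreover have "z \<in> S" using step(2) by (auto simp: cox_edges_def)
      ultimately show ?case using D' by (intro exI[of _ "insert z D'"]) auto
    qed
    then obtain D' where "finite D'" "insert x D \<subseteq> D'" "D' \<subseteq> S" "connected_in D'" by blast
    then show ?case using D(2) by (intro exI[of _ D']) auto
  qed
  then show thesis using that by blast
qed

text \<open>Minimum principle: at a zero of \<open>v\<close> every term of the sum vanishes, so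
  zeros spread to neighbours and, by connectedness, to \<open>d\<close>.\<close>

lemma supersolution_positive:
  assumes D: "finite D" "D \<subseteq> S" "connected_in D"
    and v: "\<And>x. x \<in> D \<Longrightarrow> v x \<ge> 0"
    and sup: "\<And>x. x \<in> D \<Longrightarrow> (\<Sum>y\<in>D - {x}. k y x * v y) \<le> c * v x"
    and d: "d \<in> D" "v d > 0" and x: "x \<in> D"
  shows "v x > 0"
proof -
  define A where "A = {x \<in> D. v x = 0}"
  have "y \<in> A" if "x \<in> A" "y \<in> D" "(x, y) \<in> cox_edges W S" for x y
  proof -
    have xD: "x \<in> D" "v x = 0" and "y \<noteq> x" using that by (auto simp: A_def cox_edges_def)
    have nn: "k z x * v z \<ge> 0" if "z \<in> D - {x}" for z
      using that v D(2) xD by (intro mult_nonneg_nonneg k_nonneg) auto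
    have "(\<Sum>z\<in>D - {x}. k z x * v z) = 0"
      using sup[OF xD(1)] xD(2) sum_nonneg[of "D - {x}" "\<lambda>z. k z x * v z", OF nn] by simp
    then have "k y x * v y = 0"
      using sum_nonneg_eq_0_iff[of "D - {x}" "\<lambda>z. k z x * v z"] nn D that \<open>y \<noteq> x\<close> by auto
    then show ?thesis using k_edge[OF edge_sym[OF that(3)]] that by (simp add: A_def)
  qed
  then have "A = {} \<or> A = D"
    using D(3) unfolding connected_in_def by (metis (no_types, lifting) A_def mem_Collect_eq subsetI)
  then show ?thesis using d x v[OF x] by (auto simp: A_def less_le)
qed

text \<open>The reflection in \<alpha>_s on coordinates over the simple roots, adjoint to
  \<open>fire k s\<close> under \<open>pair\<close>.\<close>

definition reflect :: "'a \<Rightarrow> ('a \<Rightarrow> real) \<Rightarrow> 'a \<Rightarrow> real" where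
  "reflect s v = v(s := v s + (\<Sum>y\<in>S. k s y * v y))"

definition form :: "('a \<Rightarrow> real) \<Rightarrow> real" where
  "form v = (\<Sum>x\<in>S. \<Sum>y\<in>S. - k x y * v x * v y)"

definition pair :: "('a \<Rightarrow> real) \<Rightarrow> ('a \<Rightarrow> real) \<Rightarrow> real" where
  "pair v f = (\<Sum>x\<in>S. v x * f x)"

lemma reduced_word_append:
  assumes "reduced_word W S (w @ [s])"
  shows "reduced_word W S w"
proof -
  have w: "w \<in> lists S" "s \<in> S" "len (prod_w w \<otimes> s) = Suc (length w)"
    using assms prod_w_append[of w "[s]"] by (auto simp: reduced_word_iff S_carrier)
  then have "len (prod_w w) \<ge> length w"
    using len_mult_le[OF prod_w_S[OF w(1)], of "[s]"] by (simp add: S_carrier)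
  then show ?thesis using w len_le[OF w(1)] by (simp add: reduced_word_iff)
qed

section \<open>Finite \<open>S\<close>: the invariant form and the positive definite case\<close>

context
  assumes fin: "finite S"
begin

lemma sum_delta_S: "s \<in> S \<Longrightarrow> (\<Sum>x\<in>S. g x * (if x = s then a else 0)) = g s * (a::real)"
  using fin by (simp add: if_distrib[of "\<lambda>z. g _ * z"] cong: if_cong)

lemma reflect_eq: "reflect s v = (\<lambda>x. v x + (if x = s then \<Sum>y\<in>S. k s y * v y else 0))"
  by (auto simp: reflect_def)

lemma pair_reflect:
  assumes "s \<in> S"
  shows "pair (reflect s v) f = pair v (fire k s f)"
proof -
  have "pair (reflect s v) f = (\<Sum>x\<in>S. v x * f x + f x * (if x = s then \<Sum>y\<in>S. k s y * v y else 0))"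
    unfolding pair_def reflect_eq by (intro sum.cong) (auto simp: algebra_simps)
  also have "\<dots> = pair v f + f s * (\<Sum>y\<in>S. k s y * v y)"
    unfolding sum.distrib sum_delta_S[OF assms] by (simp add: pair_def)
  also have "\<dots> = pair v (fire k s f)"
    by (simp add: pair_def fire_def distrib_left sum.distrib sum_distrib_left mult_ac)
  finally show ?thesis .
qed

lemma pair_reflect_word:
  assumes "w \<in> lists S"
  shows "pair (fold reflect (rev w) v) f = pair v (fire_word k w f)"
  using assms
  by (induction w arbitrary: f rule: list.induct) (auto simp: pair_reflect)

lemma gram_reflect:
  assumes "s \<in> S" "x \<in> S"
  shows "(\<Sum>y\<in>S. k x y * reflect s v y) = (\<Sum>y\<in>S. k x y * v y) + k x s * (\<Sum>y\<in>S. k s y * v y)"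
  by (simp add: reflect_eq distrib_left sum.distrib sum_delta_S[OF assms(1)])

lemma form_reflect:
  assumes s: "s \<in> S"
  shows "form (reflect s v) = form v"
proof -
  define c where "c = (\<Sum>y\<in>S. k s y * v y)"
  have form: "form u = - (\<Sum>x\<in>S. u x * (\<Sum>y\<in>S. k x y * u y))" for u
    by (simp add: form_def sum_distrib_left sum_negf mult_ac)
  have "(\<Sum>x\<in>S. reflect s v x * (\<Sum>y\<in>S. k x y * reflect s v y))
      = (\<Sum>x\<in>S. reflect s v x * ((\<Sum>y\<in>S. k x y * v y) + k x s * c))"
    using s by (intro sum.cong) (auto simp: gram_reflect c_def)
  also have "\<dots> = (\<Sum>x\<in>S. v x * (\<Sum>y\<in>S. k x y * v y) + (k x s * v x) * c
      + ((\<Sum>y\<in>S. k x y * v y) + k x s * c) * (if x = s then c else 0))"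
    by (intro sum.cong) (auto simp: reflect_eq c_def algebra_simps)
  also have "\<dots> = (\<Sum>x\<in>S. v x * (\<Sum>y\<in>S. k x y * v y)) + (\<Sum>x\<in>S. k x s * v x) * c + (c + k s s * c) * c"
    unfolding sum.distrib sum_delta_S[OF s] by (simp add: sum_distrib_right c_def)
  also have "(\<Sum>x\<in>S. k x s * v x) = c"
    unfolding c_def using s k_sym by (intro sum.cong) auto
  finally show ?thesis using s by (simp add: form k_self algebra_simps)
qed

lemma form_reflect_word: "w \<in> lists S \<Longrightarrow> form (fold reflect w v) = form v"
  by (induction w arbitrary: v rule: list.induct) (auto simp: form_reflect)

text \<open>The Gram matrix turns vectors into functionals and, \<open>k\<close> being symmetric,
  intertwines \<open>reflect\<close> with \<open>fire\<close>.\<close>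

lemma fire_gram_word:
  assumes "w \<in> lists S" "x \<in> S"
  shows "fire_word k w (\<lambda>x. \<Sum>y\<in>S. k x y * v y) x = (\<Sum>y\<in>S. k x y * fold reflect w v y)"
  using assms(1)
proof (induction w arbitrary: v rule: list.induct)
  case (Cons s w)
  then have s: "s \<in> S" "w \<in> lists S" by auto
  have "fire_word k w (fire k s (\<lambda>x. \<Sum>y\<in>S. k x y * v y)) x
      = fire_word k w (\<lambda>x. \<Sum>y\<in>S. k x y * reflect s v y) x"
  proof (rule fire_word_cong[OF s(2) _ assms(2)])
    fix z assume "z \<in> S"
    then show "fire k s (\<lambda>x. \<Sum>y\<in>S. k x y * v y) z = (\<Sum>y\<in>S. k z y * reflect s v y)"
      using s k_sym[of z s] by (simp add: fire_def gram_reflect)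
  qed
  then show ?case using Cons by simp
qed simp

text \<open>
  Every positive root has coordinate sum at least 1, since the quadratic form takes the value 2
  on it and is at most twice the sum of the squares on the positive orthant.
\<close>

lemma root_lower_bound:
  assumes "reduced_word W S (w @ [s])" and p: "\<And>x. x \<in> S \<Longrightarrow> p x \<ge> \<kappa>" "\<kappa> \<ge> 0"
  shows "fire_word k w p s \<ge> \<kappa>"
proof -
  have w: "w \<in> lists S" "rev w \<in> lists S" "s \<in> S" using assms(1) by (auto simp: reduced_word_def)
  define e where "e z = (\<lambda>x. if x = z then 1 else 0 :: real)" for z :: 'a
  \<comment> \<open>The coordinates of the root w \<alpha>_s; taking adjoints reverses the
    word.\<close>
  define \<beta> where "\<beta> = fold reflect (rev w) (e s)"
  have pair_e: "pair v (e z) = v z" "pair (e z) v = v z" if "z \<in> S" for v z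
    using sum_delta_S[OF that, of v 1] by (simp_all add: pair_def e_def mult.commute)
  have \<beta>: "pair \<beta> f = fire_word k w f s" for f
    using pair_reflect_word[OF w(1)] pair_e w by (simp add: \<beta>_def)
  have \<beta>_nonneg: "\<beta> x \<ge> 0" if "x \<in> S" for x
    using reduced_positive[OF assms(1), of "e x"] \<beta>[of "e x"] pair_e[OF that] by (simp add: e_def)
  have "form (e s) = (\<Sum>x\<in>S. (\<Sum>y\<in>S. (- k x y) * e s y) * e s x)"
    unfolding form_def sum_distrib_right by (intro sum.cong) (auto simp: mult_ac)
  also have "\<dots> = 2"
    unfolding e_def sum_delta_S[OF w(3)] using w by (simp add: k_self)
  finally have "2 = form \<beta>" using form_reflect_word[OF w(2)] by (simp add: \<beta>_def)
  also have "\<dots> \<le> (\<Sum>x\<in>S. \<Sum>y\<in>S. (2 * \<beta> x * \<beta> y) * (if y = x then 1 else 0))"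
    unfolding form_def
  proof (intro sum_mono)
    fix x y assume "x \<in> S" "y \<in> S"
    then show "- k x y * \<beta> x * \<beta> y \<le> (2 * \<beta> x * \<beta> y) * (if y = x then 1 else 0)"
      using k_nonneg[of x y] \<beta>_nonneg k_self by (cases "x = y") auto
  qed
  also have "\<dots> = (\<Sum>x\<in>S. 2 * \<beta> x * \<beta> x)"
    by (rule sum.cong) (simp, subst sum_delta_S, auto)
  also have "\<dots> \<le> (\<Sum>x\<in>S. 2 * \<beta> x * (\<Sum>y\<in>S. \<beta> y))"
    using \<beta>_nonneg fin by (intro sum_mono mult_left_mono member_le_sum) auto
  also have "\<dots> = 2 * (\<Sum>y\<in>S. \<beta> y)\<^sup>2"
    by (simp add: power2_eq_square sum_distrib_left sum_distrib_right mult_ac)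
  finally have "(\<Sum>y\<in>S. \<beta> y)\<^sup>2 \<ge> 1" by simp
  moreover have nn: "(\<Sum>y\<in>S. \<beta> y) \<ge> 0" using \<beta>_nonneg by (simp add: sum_nonneg)
  ultimately have "(\<Sum>y\<in>S. \<beta> y) \<ge> 1" using power2_le_imp_le[of 1 "\<Sum>y\<in>S. \<beta> y"] by simp
  then have "\<kappa> * 1 \<le> \<kappa> * (\<Sum>y\<in>S. \<beta> y)" using p(2) by (intro mult_left_mono)
  also have "\<dots> \<le> pair \<beta> p"
    unfolding pair_def sum_distrib_left
  proof (rule sum_mono)
    fix x assume "x \<in> S"
    then show "\<kappa> * \<beta> x \<le> \<beta> x * p x"
      using mult_right_mono[OF p(1) \<beta>_nonneg] by (simp add: mult.commute)
  qed
  finally show ?thesis using \<beta> by simp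
qed

text \<open>The pairing of \<open>p\<close> with \<open>fire_word k w p\<close> is at least -1 for
  every word, but drops by at least \<open>\<mu> * \<kappa>\<^sup>2\<close> with each letter of a
  reduced word. So reduced words have bounded length, and over a finite \<open>S\<close> there are
  finitely many.\<close>

lemma positive_definite_finite:
  assumes p: "\<And>x. x \<in> S \<Longrightarrow> p x > 0" "(\<Sum>x\<in>S. (p x)\<^sup>2) = 1"
    and eigen: "\<And>x. x \<in> S \<Longrightarrow> (\<Sum>y\<in>S. - k x y * p y) = \<mu> * p x"
    and \<mu>: "\<mu> > 0" and bound: "\<And>v. form v \<ge> \<mu> * (\<Sum>x\<in>S. (v x)\<^sup>2)"
  shows "finite (carrier W)"
proof -
  have gram: "(\<Sum>y\<in>S. k x y * p y) = - \<mu> * p x" if "x \<in> S" for x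
    using eigen[OF that] by (simp add: sum_negf)
  have "form p = (\<Sum>x\<in>S. p x * (\<Sum>y\<in>S. - k x y * p y))"
    unfolding form_def sum_distrib_left by (intro sum.cong) (auto simp: mult_ac)
  also have "\<dots> = (\<Sum>x\<in>S. \<mu> * (p x)\<^sup>2)"
    by (intro sum.cong) (simp_all only: eigen, simp_all add: power2_eq_square)
  also have "\<dots> = \<mu>" using p(2) by (simp flip: sum_distrib_left)
  finally have form_p: "form p = \<mu>" .
  \<comment> \<open>Invariance of the form keeps the squared norm of \<open>v\<close> at most 1. As
    the Gram matrix maps \<open>p\<close> to \<open>- \<mu>\<close> times itself, the pairing is the
    inner product of \<open>v\<close> and \<open>p\<close>, which a sum of squares bounds
    below.\<close>
  have lower: "pair p (fire_word k w p) \<ge> -1" if w: "w \<in> lists S" for w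
  proof -
    define v where "v = fold reflect w p"
    have "\<mu> * (\<Sum>x\<in>S. (v x)\<^sup>2) \<le> \<mu>" using bound[of v] form_reflect_word[OF w] form_p by (simp add: v_def)
    then have nv: "(\<Sum>x\<in>S. (v x)\<^sup>2) \<le> 1" using \<mu> by simp
    have "fire_word k w p x = (\<Sum>y\<in>S. k x y * v y) / - \<mu>" if "x \<in> S" for x
    proof -
      have "(\<Sum>y\<in>S. k x y * v y) = fire_word k w (\<lambda>x. \<Sum>y\<in>S. k x y * p y) x"
        by (simp add: fire_gram_word[OF w that] v_def)
      also have "\<dots> = fire_word k w (\<lambda>x. - \<mu> * p x) x"
        by (rule fire_word_cong[OF w _ that]) (rule gram)
      also have "\<dots> = - \<mu> * fire_word k w p x" by (rule fire_word_scale)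
      finally show ?thesis using \<mu> by simp
    qed
    then have "pair p (fire_word k w p) = (\<Sum>x\<in>S. \<Sum>y\<in>S. p x * (k x y * v y)) / - \<mu>"
      by (simp add: pair_def sum_distrib_left sum_divide_distrib sum_negf)
    also have "(\<Sum>x\<in>S. \<Sum>y\<in>S. p x * (k x y * v y)) = (\<Sum>y\<in>S. v y * (\<Sum>x\<in>S. k y x * p x))"
      unfolding sum_distrib_left
      by (subst sum.swap, intro sum.cong) (auto simp: k_sym)
    also have "\<dots> = (\<Sum>y\<in>S. v y * (- \<mu> * p y))" by (intro sum.cong) (auto simp: gram)
    also have "\<dots> = - \<mu> * (\<Sum>y\<in>S. v y * p y)" by (simp add: sum_distrib_left sum_negf mult_ac)
    finally have eq: "pair p (fire_word k w p) = (\<Sum>y\<in>S. v y * p y)" using \<mu> by simp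
    have "0 \<le> (\<Sum>y\<in>S. (v y + p y)\<^sup>2)" by (intro sum_nonneg) auto
    also have "\<dots> = (\<Sum>y\<in>S. (v y)\<^sup>2) + (\<Sum>y\<in>S. (p y)\<^sup>2) + 2 * (\<Sum>y\<in>S. v y * p y)"
      unfolding sum_distrib_left sum.distrib[symmetric]
      by (intro sum.cong) (auto simp: power2_eq_square algebra_simps)
    finally show ?thesis using nv p(2) eq by simp
  qed
  have "S \<noteq> {}" using p(2) by auto
  define \<kappa> where "\<kappa> = Min (p ` S)"
  have \<kappa>: "\<kappa> > 0" "\<And>x. x \<in> S \<Longrightarrow> p x \<ge> \<kappa>"
    using fin \<open>S \<noteq> {}\<close> p(1) by (auto simp: \<kappa>_def)
  \<comment> \<open>By the eigenvalue equation firing \<open>s\<close> subtracts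
    \<open>\<mu> * (p s * f s)\<close>, and \<open>root_lower_bound\<close> gives
    \<open>f s \<ge> \<kappa>\<close>.\<close>
  have upper: "pair p (fire_word k w p) \<le> 1 - length w * (\<mu> * \<kappa>\<^sup>2)" if "reduced_word W S w" for w
    using that
  proof (induction w rule: rev_induct)
    case Nil
    then show ?case using p(2) by (simp add: pair_def power2_eq_square)
  next
    case (snoc s w)
    have s: "s \<in> S" using snoc.prems by (auto simp: reduced_word_def)
    define f where "f = fire_word k w p"
    have fs: "f s \<ge> \<kappa>" unfolding f_def
      using root_lower_bound[OF snoc.prems] \<kappa> by (simp add: less_imp_le)
    have "pair p (fire_word k (w @ [s]) p) = (\<Sum>x\<in>S. p x * f x + k s x * p x * f s)"
      by (simp add: f_def[symmetric] pair_def fire_def algebra_simps)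
    also have "\<dots> = pair p f + (\<Sum>x\<in>S. k s x * p x) * f s"
      unfolding sum.distrib by (simp add: pair_def flip: sum_distrib_right)
    also have "\<dots> = pair p f - \<mu> * (p s * f s)" using gram[OF s] by simp
    also have "\<dots> \<le> pair p f - \<mu> * (\<kappa> * \<kappa>)"
      using fs \<kappa>(1) \<kappa>(2)[OF s] \<mu> by (intro diff_left_mono mult_left_mono mult_mono) auto
    also have "\<dots> \<le> 1 - length (w @ [s]) * (\<mu> * \<kappa>\<^sup>2)"
      using snoc.IH[OF reduced_word_append[OF snoc.prems]]
      by (simp add: f_def power2_eq_square algebra_simps)
    finally show ?case .
  qed
  define N where "N = nat \<lceil>2 / (\<mu> * \<kappa>\<^sup>2)\<rceil>"
  have short: "length w \<le> N" if "reduced_word W S w" for w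
  proof -
    have "length w * (\<mu> * \<kappa>\<^sup>2) \<le> 2"
      using lower[of w] upper[OF that] that by (auto simp: reduced_word_def)
    then have "length w \<le> 2 / (\<mu> * \<kappa>\<^sup>2)" using \<mu> \<kappa>(1) by (simp add: field_simps)
    then show ?thesis unfolding N_def by linarith
  qed
  have "carrier W \<subseteq> prod_w ` {w. set w \<subseteq> S \<and> length w \<le> N}"
  proof
    fix g assume "g \<in> carrier W"
    then obtain w where w: "w \<in> lists S" "length w = len g" "prod_w w = g" using len_word by metis
    then have "reduced_word W S w" by (simp add: reduced_word_iff)
    then show "g \<in> prod_w ` {w. set w \<subseteq> S \<and> length w \<le> N}" using short w by auto
  qed
  then show ?thesis using finite_lists_length_le[OF fin] finite_surj by blast
qed

end

section \<open>Construction of the subharmonic vector\<close>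

lemma ex_subharmonic:
  assumes inf: "infinite (carrier W)" and irr: "coxeter_irreducible W S"
    and T: "finite T" "T \<subseteq> S" "T \<noteq> {}"
  obtains \<delta> D where "finite D" "D \<subseteq> S" "T \<subseteq> D" "\<And>x. x \<in> T \<Longrightarrow> \<delta> x > 0"
    "\<And>x. x \<in> T \<Longrightarrow> 2 * \<delta> x \<le> (\<Sum>y\<in>D - {x}. k y x * \<delta> y)"
proof -
  obtain D where D: "finite D" "T \<subseteq> D" "D \<subseteq> S" "connected_in D"
    using finite_connected_superset[OF irr T] by blast
  have D0: "D \<noteq> {}" using D T by auto
  obtain p \<mu> where p: "\<And>x. p x \<ge> 0" "(\<Sum>x\<in>D. (p x)\<^sup>2) = 1"
    "\<And>x. x \<in> D \<Longrightarrow> (\<Sum>y\<in>D. - k x y * p y) = \<mu> * p x"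
    "\<And>v. (\<Sum>x\<in>D. \<Sum>y\<in>D. - k x y * v x * v y) \<ge> \<mu> * (\<Sum>x\<in>D. (v x)\<^sup>2)"
  proof (rule bottom_eigenvector[OF D(1) D0, of "\<lambda>x y. - k x y"])
    show "- k x y = - k y x" if "x \<in> D" "y \<in> D" for x y
      using that D(3) k_sym[of x y] by auto
    show "- k x y \<le> 0" if "x \<in> D" "y \<in> D" "x \<noteq> y" for x y
      using that D(3) k_nonneg[of x y] by auto
  qed (rule that)
  have eigen: "(\<Sum>y\<in>D - {x}. k y x * p y) = (2 - \<mu>) * p x" if x: "x \<in> D" for x
  proof -
    have "(\<Sum>y\<in>D. - k x y * p y) = - k x x * p x + (\<Sum>y\<in>D - {x}. - k x y * p y)"
      using x D by (intro sum.remove) auto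
    moreover have "(\<Sum>y\<in>D - {x}. - k x y * p y) = - (\<Sum>y\<in>D - {x}. k y x * p y)"
      unfolding sum_negf[symmetric]
    proof (rule sum.cong)
      fix y assume "y \<in> D - {x}"
      then show "- k x y * p y = - (k y x * p y)" using x D(3) k_sym[of x y] by auto
    qed simp
    ultimately show ?thesis using p(3)[OF x] k_self[of x] x D by (auto simp: algebra_simps)
  qed
  have "\<not> (\<forall>x\<in>D. p x = 0)"
  proof
    assume "\<forall>x\<in>D. p x = 0"
    then have "(\<Sum>x\<in>D. (p x)\<^sup>2) = 0" by simp
    then show False using p(2) by simp
  qed
  then obtain d where d: "d \<in> D" "p d \<noteq> 0" by blast
  have p_pos: "p x > 0" if "x \<in> D" for x
    using supersolution_positive[of D p "2 - \<mu>" d x] D p(1) eigen d that by (simp add: less_le)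
  show thesis
  proof (cases "\<mu> \<le> 0")
    case True
    have "2 * p x \<le> (\<Sum>y\<in>D - {x}. k y x * p y)" if "x \<in> T" for x
      using True p_pos[of x] eigen[of x] that D(2) mult_right_mono[of 2 "2 - \<mu>" "p x"] by auto
    then show thesis using that[of D p] D p_pos by blast
  next
    case False
    then have \<mu>: "\<mu> > 0" by simp
    have "D \<noteq> S"
    proof
      assume DS: "D = S"
      then have "finite (carrier W)"
        using positive_definite_finite[of p \<mu>] D(1) p p_pos \<mu> by (simp add: form_def)
      then show False using inf by simp
    qed
    then obtain s where s: "s \<in> S" "s \<notin> D" using D by blast
    have "(d, s) \<in> (cox_edges W S)\<^sup>*" using irr d D s by (auto simp: coxeter_irreducible_def)
    \<comment> \<open>A path from \<open>d\<close> to a generator outside \<open>D\<close> leaves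
      \<open>D\<close> along some edge.\<close>
    then have "\<exists>a b. a \<in> D \<and> b \<notin> D \<and> (a, b) \<in> cox_edges W S"
      using s(2)
    proof induction
      case base
      then show ?case using d by simp
    next
      case (step y z)
      then show ?case by blast
    qed
    then obtain a b where ab: "a \<in> D" "b \<notin> D" "(a, b) \<in> cox_edges W S" by blast
    have b: "b \<in> S" using ab by (auto simp: cox_edges_def)
    \<comment> \<open>Large enough for \<open>c * p\<close> to be a supersolution with source term
      \<open>k b\<close>: by \<open>eigen\<close> its surplus at \<open>x\<close> is
      \<open>c * (\<mu> * p x)\<close>.\<close>
    define c where "c = Max ((\<lambda>x. k b x / (\<mu> * p x)) ` D)"
    have c: "k b x \<le> c * (\<mu> * p x)" if "x \<in> D" for x
    proof -
      have "k b x / (\<mu> * p x) \<le> c" using that D by (simp add: c_def)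
      then show ?thesis using \<mu> p_pos[OF that] by (simp add: field_simps)
    qed
    have kb: "k b x \<ge> 0" if "x \<in> D" for x using that b ab D k_nonneg[of b x] by auto
    have "\<mu> * p d > 0" using \<mu> p_pos[OF d(1)] by simp
    then have c0: "c \<ge> 0"
      using c[OF d(1)] kb[OF d(1)] mult_neg_pos[of c "\<mu> * p d"] by linarith
    obtain v where v: "\<And>x. x \<in> D \<Longrightarrow> v x \<ge> 0"
      "\<And>x. x \<in> D \<Longrightarrow> 2 * v x = (\<Sum>y\<in>D - {x}. k y x * v y) + k b x"
    proof (rule largest_subsolution[of D k "k b" "\<lambda>x. c * p x"])
      show "k y x \<ge> 0" if "x \<in> D" "y \<in> D - {x}" for x y
        using that D k_nonneg[of y x] by auto
      show "(\<Sum>y\<in>D - {x}. k y x * (c * p y)) + k b x \<le> 2 * (c * p x)" if "x \<in> D" for x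
      proof -
        have "(\<Sum>y\<in>D - {x}. k y x * (c * p y)) = c * (\<Sum>y\<in>D - {x}. k y x * p y)"
          by (simp add: sum_distrib_left mult_ac)
        also have "\<dots> = c * ((2 - \<mu>) * p x)" unfolding eigen[OF that] ..
        finally show ?thesis using c[OF that] by (simp add: algebra_simps)
      qed
    qed (use kb c0 p(1) in auto)
    \<comment> \<open>The edge to \<open>b\<close> makes the source term positive at
      \<open>a\<close>; the minimum principle then spreads positivity over \<open>D\<close>.\<close>
    have "2 * v a > 0"
    proof -
      have "(\<Sum>y\<in>D - {a}. k y a * v y) \<ge> 0"
        using v(1) ab D(3) by (intro sum_nonneg mult_nonneg_nonneg k_nonneg) auto
      then show ?thesis using v(2)[OF ab(1)] k_edge[OF edge_sym[OF ab(3)]] by simp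
    qed
    then have "v a > 0" by simp
    moreover have "(\<Sum>y\<in>D - {x}. k y x * v y) \<le> 2 * v x" if "x \<in> D" for x
      using v(2)[OF that] kb[OF that] by simp
    ultimately have v_pos: "v x > 0" if "x \<in> D" for x
      using supersolution_positive[of D v 2 a x] D(1,3,4) v(1) ab(1) that by blast
    \<comment> \<open>The boundary value 1 at \<open>b\<close> accounts for the source term
      \<open>k b x\<close>, so the required inequality is an equality on all of
      \<open>D\<close>.\<close>
    define \<delta> where "\<delta> = v(b := 1)"
    have \<delta>: "2 * \<delta> x = (\<Sum>y\<in>insert b D - {x}. k y x * \<delta> y)" if "x \<in> D" for x
    proof -
      have "x \<noteq> b" using that ab by blast
      then have "insert b D - {x} = insert b (D - {x})" by blast
      then have "(\<Sum>y\<in>insert b D - {x}. k y x * \<delta> y) = k b x + (\<Sum>y\<in>D - {x}. k y x * \<delta> y)"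
        using D ab by (simp add: \<delta>_def)
      also have "(\<Sum>y\<in>D - {x}. k y x * \<delta> y) = (\<Sum>y\<in>D - {x}. k y x * v y)"
        using ab by (intro sum.cong) (auto simp: \<delta>_def)
      finally show ?thesis using v(2)[OF that] \<open>x \<noteq> b\<close> by (simp add: \<delta>_def)
    qed
    show thesis
    proof (rule that[of "insert b D" \<delta>])
      show "\<delta> x > 0" if "x \<in> T" for x using v_pos[of x] that ab D(2) by (auto simp: \<delta>_def)
      show "2 * \<delta> x \<le> (\<Sum>y\<in>insert b D - {x}. k y x * \<delta> y)" if "x \<in> T" for x
        using \<delta>[of x] that D(2) by auto
    qed (use D b in auto)
  qed
qed

end

theorem theorem1p2:
  fixes W :: "('a, 'b) monoid_scheme" and S :: "'a set"
  assumes "coxeter_system W S"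
    and "infinite (carrier W)"
    and "coxeter_irreducible W S"
  shows "\<forall>w \<in> lists S. intervening_neighbours W S w \<longrightarrow> reduced_word W S w"
proof (intro ballI impI)
  fix w assume w: "w \<in> lists S" "intervening_neighbours W S w"
  interpret coxeter W S using assms(1) by unfold_locales
  show "reduced_word W S w"
  proof (cases "w = []")
    case True
    then show ?thesis by (simp add: reduced_word_def)
  next
    case False
    have T: "finite (set w)" "set w \<subseteq> S" "set w \<noteq> {}" using w False by auto
    show ?thesis
    proof (rule ex_subharmonic[OF assms(2,3) T])
      fix \<delta> D
      assume "finite D" "D \<subseteq> S" "set w \<subseteq> D" "\<And>x. x \<in> set w \<Longrightarrow> \<delta> x > 0"
        "\<And>x. x \<in> set w \<Longrightarrow> 2 * \<delta> x \<le> (\<Sum>y\<in>D - {x}. cox_k W y x * \<delta> y)"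
      then show ?thesis by (rule intervening_reduced[OF _ _ _ _ _ order_refl w(2)])
    qed
  qed
qed

end
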